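(* Let $d\leq 5$ (and $n>d$), let $D$ be a regular $(n-d)$-domino tiling of $[0,2]^n$ with a simple component $C\subset D$, and let $Q$ be the simple $(n-d)$-domino tiling of $[0,2]^n$ such that $C\subset Q$. Then it is possible to pass by flips from $D$ to $Q$ keeping $C$ fixed, i.e. there is a sequence of tilings $D=D^1,\dots,D^{m}=Q$ with each $D^{t+1}$ obtained from $D^t$ by a flip and $C\subset D^t$ for all $t$.
   Context: For integers $n>d\geq 1$, an $(n-d)$-domino is a box $I_1\times\cdots\times I_n\subset[0,2]^n$ such that for some $N\subset[n]$ with $|N|=d$ we have $I_j\in\{[0,1],[1,2]\}$ for $j\in N$ and $I_i=[0,2]$ for $i\notin N$; it is identified with the word $u\in\{0,1,*\}^n$ with $u_j=0,1,*$ according as $I_j=[0,1],[1,2],[0,2]$, and $\mathrm{prop}(u)=\{j\in[n]\colon u_j\neq *\}$. A family of $(n-d)$-dominoes is a tiling of $[0,2]^n$ if interiors of distinct members are disjoint and their union is $[0,2]^n$; we regard it as a set $D$ of words. Two $(n-d)$-dominoes $A,B$ form a twin pair if $A\cup B$ is an $(n-(d-1))$-domino. If $C',D'$ is a twin pair with $C'\cup D'=A\cup B$ and $\{C',D'\}\neq\{A,B\}$, then $C',D'$ is a flip of $A,B$. A tiling $\mathcal D'$ is obtained from $\mathcal D$ by a flip if there is a twin pair $A,B\in\mathcal D$ and a flip $C',D'$ of it with $\mathcal D'=(\mathcal D\setminus\{A,B\})\cup\{C',D'\}$. A subset $C\subset D$ is a simple component of $D$ if $\mathrm{prop}(v)=\mathrm{prop}(w)$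 for all $v,w\in C$ and $\mathrm{prop}(v)\neq\mathrm{prop}(u)$ for all $v\in C$, $u\in D\setminus C$. A tiling is simple if all its words have the same $\mathrm{prop}$. A tiling $D$ is regular if there is a partition $[n]=N_1\,\dot\cup\cdots\dot\cup\,N_d\,\dot\cup\,N^*$ ($N^*$ possibly empty) such that: ($\alpha$) for each $i\in[d]$, $N_i\neq\emptyset$ and the set $\{u|_{N_i}\colon u\in D\}$ of restrictions of words of $D$ to the positions in $N_i$ is exactly the set of all words of length $|N_i|$ over $\{0,1,*\}$ with exactly one entry different from $*$; ($\beta$) $u_j=*$ for all $u\in D$ and $j\in N^*$. *)

theory Defs
  imports "HOL-Analysis.Analysis"
begin

datatype letter = Zero | One | Star

text \<open>Words of length \<open>n\<close> are functions \<open>'n \<Rightarrow> letter\<close>, where the finite type \<open>'n\<close> plays the role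
  of the set of positions and \<open>n = CARD('n)\<close>.\<close>

type_synonym 'n word = "'n \<Rightarrow> letter"

fun side :: "letter \<Rightarrow> real set" where
  "side Zero = {0..1}"
| "side One = {1..2}"
| "side Star = {0..2}"

definition domino :: "'n::finite word \<Rightarrow> (real ^ 'n) set" where
  "domino u = {x. \<forall>j. x $ j \<in> side (u j)}"

definition propset :: "'n::finite word \<Rightarrow> 'n set" where
  "propset u = {j. u j \<noteq> Star}"

text \<open>The word \<open>u\<close> encodes an \<open>(n - d)\<close>-domino: exactly \<open>d\<close> sides are halved.\<close>

definition domino_word :: "nat \<Rightarrow> 'n::finite word \<Rightarrow> bool" where
  "domino_word d u \<longleftrightarrow> card (propset u) = d"

definition tiling :: "nat \<Rightarrow> 'n::finite word set \<Rightarrow> bool" where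
  "tiling d D \<longleftrightarrow>
     (\<forall>u\<in>D. domino_word d u) \<and>
     (\<forall>u\<in>D. \<forall>v\<in>D. u \<noteq> v \<longrightarrow> interior (domino u) \<inter> interior (domino v) = {}) \<and>
     (\<Union>u\<in>D. domino u) = {x. \<forall>j. x $ j \<in> {0..2}}"

text \<open>For \<open>d = 1\<close> the union of a twin pair is the whole cube, the domino of the all-\<open>Star\<close> word.\<close>

definition twin_pair :: "nat \<Rightarrow> 'n::finite word \<Rightarrow> 'n word \<Rightarrow> bool" where
  "twin_pair d A B \<longleftrightarrow> domino_word d A \<and> domino_word d B \<and>
     (\<exists>w. domino_word (d - 1) w \<and> domino A \<union> domino B = domino w)"

definition is_flip :: "nat \<Rightarrow> 'n::finite word \<Rightarrow> 'n word \<Rightarrow> 'n word \<Rightarrow> 'n word \<Rightarrow> bool" where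
  "is_flip d A B A' B' \<longleftrightarrow> twin_pair d A B \<and> twin_pair d A' B' \<and>
     domino A' \<union> domino B' = domino A \<union> domino B \<and> {A', B'} \<noteq> {A, B}"

definition flip_step :: "nat \<Rightarrow> 'n::finite word set \<Rightarrow> 'n word set \<Rightarrow> bool" where
  "flip_step d D D' \<longleftrightarrow> tiling d D \<and> tiling d D' \<and>
     (\<exists>A\<in>D. \<exists>B\<in>D. \<exists>A' B'. is_flip d A B A' B' \<and> D' = (D - {A, B}) \<union> {A', B'})"

definition simple_component :: "'n::finite word set \<Rightarrow> 'n word set \<Rightarrow> bool" where
  "simple_component C D \<longleftrightarrow> C \<subseteq> D \<and>
     (\<forall>v\<in>C. \<forall>w\<in>C. propset v = propset w) \<and>
     (\<forall>v\<in>C. \<forall>u\<in>D - C. propset v \<noteq> propset u)"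

definition simple_tiling :: "nat \<Rightarrow> 'n::finite word set \<Rightarrow> bool" where
  "simple_tiling d Q \<longleftrightarrow> tiling d Q \<and> (\<forall>u\<in>Q. \<forall>v\<in>Q. propset u = propset v)"

text \<open>Words over a set \<open>S\<close> of positions are represented by extensional functions on \<open>S\<close>, so that
  \<open>restrict u S\<close> is the restriction of \<open>u\<close> to \<open>S\<close>. The set \<open>M\<close> below is the part \<open>N\<^sup>*\<close> of the partition.\<close>

definition regular_tiling :: "nat \<Rightarrow> 'n::finite word set \<Rightarrow> bool" where
  "regular_tiling d D \<longleftrightarrow> tiling d D \<and>
     (\<exists>(N :: nat \<Rightarrow> 'n set) M.
        disjoint_family_on N {1..d} \<and>
        (\<forall>i\<in>{1..d}. N i \<inter> M = {}) \<and>
        (\<Union>i\<in>{1..d}. N i) \<union> M = UNIV \<and>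
        (\<forall>i\<in>{1..d}. N i \<noteq> {} \<and>
           (\<lambda>u. restrict u (N i)) ` D =
             {w \<in> N i \<rightarrow>\<^sub>E UNIV. \<exists>!j. j \<in> N i \<and> w j \<noteq> Star}) \<and>
        (\<forall>u\<in>D. \<forall>j\<in>M. u j = Star))"

end

theory Submission
  imports Defs
begin

text \<open>Reading \<open>Zero\<close>/\<open>One\<close> at the non-star positions as coordinates, the words of a regular tiling
  correspond to the vertices of the \<open>d\<close>-cube: in direction \<open>i\<close> a vertex is labelled by the position
  in \<open>N i\<close> at which its word is not \<open>Star\<close>, and the dominoes tile iff any two vertices have a
  common label in some direction in which they differ. In particular the two ends of an edge in
  direction \<open>i\<close> have the same label there, and a flip relabels, in direction \<open>i\<close>, an edge whose ends
  agree in all labels.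

  Let \<open>P\<close> be the labels of \<open>C\<close> and take, among the labellings that can be reached with \<open>C\<close> fixed,
  one with the fewest labels outside \<open>P\<close>. If the labels in some direction are constant, split the
  cube in that direction and use induction. Otherwise no edge with a label outside \<open>P\<close> can be
  flipped, nor is there a flip that makes two such edges flippable. For \<open>d \<le> 5\<close> these two conditions
  force the neighbours of a vertex with labels \<open>P\<close> to have labels \<open>P\<close> as well, so all vertices have.
  For this, draw an arc from \<open>i\<close> to \<open>j\<close> if the \<open>i\<close>-th neighbour has a label outside \<open>P\<close> in
  direction \<open>j\<close>; there are no opposite arcs, which leaves few configurations, each refuted by a
  propositional argument.\<close>

section \<open>The labellings of the cube\<close>

text \<open>The vertices of the cube are the subsets of \<open>I\<close>; \<open>tog i S\<close> is
  the other end of the edge at \<open>S\<close> in direction \<open>i\<close>.\<close>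

definition tog :: "'i \<Rightarrow> 'i set \<Rightarrow> 'i set" where
  "tog i S = sym_diff S {i}"

lemma in_tog: "k \<in> tog i S \<longleftrightarrow> (if k = i then k \<notin> S else k \<in> S)"
  by (auto simp: tog_def)

lemma tog_tog [simp]: "tog i (tog i S) = S"
  by (auto simp: tog_def)

lemma tog_commute: "tog i (tog j S) = tog j (tog i S)"
  by (auto simp: tog_def)

lemma tog_subset [simp]: "i \<in> I \<Longrightarrow> tog i S \<subseteq> I \<longleftrightarrow> S \<subseteq> I"
  by (auto simp: tog_def)

lemma tog_eq_iff [simp]: "tog i S = tog j S \<longleftrightarrow> i = j"
  by (auto simp: tog_def)

lemma tog_neq [simp]: "tog i S \<noteq> S" "S \<noteq> tog i S"
  by (auto simp: tog_def)

definition cube_code :: "'i set \<Rightarrow> ('i set \<Rightarrow> 'i \<Rightarrow> 'a) \<Rightarrow> bool" where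
  "cube_code I l \<longleftrightarrow> (\<forall>S\<subseteq>I. \<forall>T\<subseteq>I. S \<noteq> T \<longrightarrow> (\<exists>i\<in>sym_diff S T. l S i = l T i))"

text \<open>Both ends of the edge get the new label, because in a cube code they always share their
  label in direction \<open>i\<close>.\<close>

definition relabel :: "('i set \<Rightarrow> 'i \<Rightarrow> 'a) \<Rightarrow> 'i set \<Rightarrow> 'i \<Rightarrow> 'a \<Rightarrow> ('i set \<Rightarrow> 'i \<Rightarrow> 'a)" where
  "relabel l S i z = (\<lambda>T j. if j = i \<and> (T = S \<or> T = tog i S) then z else l T j)"

definition twin :: "'i set \<Rightarrow> ('i set \<Rightarrow> 'i \<Rightarrow> 'a) \<Rightarrow> 'i set \<Rightarrow> 'i \<Rightarrow> bool" where
  "twin I l S i \<longleftrightarrow> S \<subseteq> I \<and> i \<in> I \<and> (\<forall>j\<in>I. j \<noteq> i \<longrightarrow> l S j = l (tog i S) j)"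

definition move :: "'i set \<Rightarrow> ('i \<Rightarrow> 'a set) \<Rightarrow> 'i set set \<Rightarrow>
    ('i set \<Rightarrow> 'i \<Rightarrow> 'a) \<Rightarrow> ('i set \<Rightarrow> 'i \<Rightarrow> 'a) \<Rightarrow> bool" where
  "move I N K l l' \<longleftrightarrow>
     (\<exists>S i z. twin I l S i \<and> z \<in> N i \<and> S \<notin> K \<and> tog i S \<notin> K \<and> l' = relabel l S i z)"

definition labelling :: "'i set \<Rightarrow> ('i \<Rightarrow> 'a set) \<Rightarrow> ('i set \<Rightarrow> 'i \<Rightarrow> 'a) \<Rightarrow> bool" where
  "labelling I N l \<longleftrightarrow> cube_code I l \<and> (\<forall>S\<subseteq>I. \<forall>i\<in>I. l S i \<in> N i)"

definition pure :: "'i set \<Rightarrow> ('i \<Rightarrow> 'a) \<Rightarrow> ('i \<Rightarrow> 'a) \<Rightarrow> bool" where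
  "pure I P w \<longleftrightarrow> (\<forall>i\<in>I. w i = P i)"

lemma cube_codeD:
  assumes "cube_code I l" "S \<subseteq> I" "T \<subseteq> I" "S \<noteq> T"
  obtains i where "i \<in> I" "i \<in> S \<longleftrightarrow> i \<notin> T" "l S i = l T i"
proof -
  obtain i where i: "i \<in> sym_diff S T" "l S i = l T i"
    using assms unfolding cube_code_def by meson
  show thesis
  proof (rule that)
    show "i \<in> I" "i \<in> S \<longleftrightarrow> i \<notin> T" using i(1) assms(2,3) by auto
    show "l S i = l T i" by fact
  qed
qed

text \<open>The two ends differ in direction \<open>i\<close> only, so no other direction can supply
  the common label.\<close>

lemma cube_code_tog:
  assumes "cube_code I l" "S \<subseteq> I" "i \<in> I"
  shows "l (tog i S) i = l S i"
proof -
  have "tog i S \<subseteq> I" "tog i S \<noteq> S" using assms by simp_all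
  then obtain j where "j \<in> tog i S \<longleftrightarrow> j \<notin> S" "l (tog i S) j = l S j"
    using assms by (metis cube_codeD)
  moreover from this have "j = i" by (auto simp: in_tog split: if_splits)
  ultimately show ?thesis by simp
qed

lemma relabel_other [simp]: "j \<noteq> i \<Longrightarrow> relabel l S i z T j = l T j"
  by (simp add: relabel_def)

lemma relabel_outside [simp]: "T \<noteq> S \<Longrightarrow> T \<noteq> tog i S \<Longrightarrow> relabel l S i z T = l T"
  by (auto simp: relabel_def)

lemma relabel_same [simp]: "relabel l S i z S i = z" "relabel l S i z (tog i S) i = z"
  by (auto simp: relabel_def)

text \<open>Only a pair \<open>T\<close>, \<open>U\<close> with \<open>T\<close> on the edge and
  \<open>U\<close> off it can lose its common label, namely when that label was in direction
  \<open>i\<close>. Then \<open>tog i T\<close> and \<open>U\<close> agree in their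
  \<open>i\<close>-th coordinate, so their common label lies in another direction \<open>k\<close>,
  and the twin condition hands it over to \<open>T\<close>.\<close>

lemma cube_code_relabel:
  assumes code: "cube_code I l" and twin: "twin I l S i"
  shows "cube_code I (relabel l S i z)"
proof -
  let ?l = "relabel l S i z"
  have S: "S \<subseteq> I" "i \<in> I" using twin by (auto simp: twin_def)
  have tw: "l (tog i T) j = l T j" if "T = S \<or> T = tog i S" "j \<in> I" "j \<noteq> i" for T j
    using twin that by (auto simp: twin_def)
  have one: "\<exists>j\<in>I. (j \<in> T \<longleftrightarrow> j \<notin> U) \<and> ?l T j = ?l U j"
    if T: "T = S \<or> T = tog i S" and U: "U \<subseteq> I" "T \<noteq> U" for T U
  proof (cases "U = S \<or> U = tog i S")
    case True
    then have "U = tog i T" using T U by auto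
    then show ?thesis using T S by (auto simp: in_tog intro!: bexI [of _ i])
  next
    case False
    have TI: "T \<subseteq> I" using T S by (elim disjE) simp_all
    obtain j where j: "j \<in> I" "j \<in> T \<longleftrightarrow> j \<notin> U" "l T j = l U j"
      using code TI U by (rule cube_codeD)
    show ?thesis
    proof (cases "j = i")
      case False
      then show ?thesis using j by (intro bexI [of _ j]) auto
    next
      case True
      have "tog i T \<subseteq> I" "tog i T \<noteq> U" using TI S T False by auto
      with code U(1) obtain k where k: "k \<in> I" "k \<in> tog i T \<longleftrightarrow> k \<notin> U" "l (tog i T) k = l U k"
        by (metis cube_codeD)
      have "k \<noteq> i" using k(2) j(2) True by (auto simp: in_tog)
      then show ?thesis using k tw [OF T k(1)] by (intro bexI [of _ k]) (auto simp: in_tog)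
    qed
  qed
  show ?thesis
    unfolding cube_code_def
  proof (intro allI impI)
    fix T U assume TU: "T \<subseteq> I" "U \<subseteq> I" "T \<noteq> U"
    consider "T = S \<or> T = tog i S" | "U = S \<or> U = tog i S"
      | "\<not> (T = S \<or> T = tog i S)" "\<not> (U = S \<or> U = tog i S)" by blast
    then have "\<exists>j\<in>I. (j \<in> T \<longleftrightarrow> j \<notin> U) \<and> ?l T j = ?l U j"
    proof cases
      case 1
      then show ?thesis using one TU by blast
    next
      case 2
      then obtain j where "j \<in> I" "j \<in> U \<longleftrightarrow> j \<notin> T" "?l U j = ?l T j" using one [of U T] TU by auto
      then show ?thesis by (intro bexI [of _ j]) auto
    next
      case 3
      obtain j where "j \<in> I" "j \<in> T \<longleftrightarrow> j \<notin> U" "l T j = l U j" using code TU by (rule cube_codeD)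
      then show ?thesis using 3 by (intro bexI [of _ j]) auto
    qed
    then show "\<exists>j\<in>sym_diff T U. ?l T j = ?l U j" by blast
  qed
qed

lemma move_labelling: "move I N K l l' \<Longrightarrow> labelling I N l \<Longrightarrow> labelling I N l'"
  unfolding move_def labelling_def
  by (auto simp: cube_code_relabel) (auto simp: relabel_def)

lemma move_keeps: "move I N K l l' \<Longrightarrow> S \<in> K \<Longrightarrow> l' S = l S"
  unfolding move_def by (metis relabel_outside)

lemma moves_labelling: "(move I N K)\<^sup>*\<^sup>* l l' \<Longrightarrow> labelling I N l \<Longrightarrow> labelling I N l'"
  by (induction rule: rtranclp_induct) (auto intro: move_labelling)

lemma moves_keep: "(move I N K)\<^sup>*\<^sup>* l l' \<Longrightarrow> S \<in> K \<Longrightarrow> l' S = l S"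
  by (induction rule: rtranclp_induct) (auto dest: move_keeps)

section \<open>Wrong labels and labellings that minimize their number\<close>

definition defect :: "'i set \<Rightarrow> ('i \<Rightarrow> 'a) \<Rightarrow> ('i set \<Rightarrow> 'i \<Rightarrow> 'a) \<Rightarrow> nat" where
  "defect I P l = card {(S, i). S \<subseteq> I \<and> i \<in> I \<and> l S i \<noteq> P i}"

text \<open>Only the two ends of the edge can change their status in direction \<open>i\<close>, and
  they change it together. The correction terms stand on both sides to avoid subtraction of natural
  numbers.\<close>

lemma defect_relabel:
  assumes "finite I" "S \<subseteq> I" "i \<in> I" "l (tog i S) i = l S i"
  shows "defect I P (relabel l S i z) + 2 * of_bool (l S i \<noteq> P i) = defect I P l + 2 * of_bool (z \<noteq> P i)"
proof -
  let ?A = "\<lambda>l. {(S, i). S \<subseteq> I \<and> i \<in> I \<and> l S i \<noteq> P i}"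
  let ?B = "{(S, i), (tog i S, i)}"
  have fin: "finite (?A l)" for l
    by (rule finite_subset [of _ "Pow I \<times> I"]) (use assms(1) in auto)
  have cB: "card ?B = 2" by simp
  have split: "card (?A l) = card (?A l - ?B) + card (?A l \<inter> ?B)" for l
    using card_Diff_subset_Int [of "?A l" ?B] card_mono [OF fin, of "?A l \<inter> ?B" l] by simp
  have 1: "?A (relabel l S i z) - ?B = ?A l - ?B"
    by (auto simp: relabel_def)
  have 2: "?A l \<inter> ?B = (if l S i \<noteq> P i then ?B else {})"
    using assms by auto
  have 3: "?A (relabel l S i z) \<inter> ?B = (if z \<noteq> P i then ?B else {})"
    using assms by auto
  show ?thesis
    unfolding defect_def split [of l] split [of "relabel l S i z"] 1 2 3 using cB by auto
qed

definition minimal :: "'i set \<Rightarrow> ('i \<Rightarrow> 'a set) \<Rightarrow> 'i set set \<Rightarrow> ('i \<Rightarrow> 'a) \<Rightarrow> ('i set \<Rightarrow> 'i \<Rightarrow> 'a) \<Rightarrow> bool" where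
  "minimal I N K P l \<longleftrightarrow> (\<forall>l'. (move I N K)\<^sup>*\<^sup>* l l' \<longrightarrow> defect I P l \<le> defect I P l')"

lemma minimal_reachable:
  obtains l' where "(move I N K)\<^sup>*\<^sup>* l l'" "minimal I N K P l'"
proof -
  obtain l' where l': "(move I N K)\<^sup>*\<^sup>* l l'"
    "\<And>l''. (move I N K)\<^sup>*\<^sup>* l l'' \<Longrightarrow> defect I P l' \<le> defect I P l''"
    using ex_has_least_nat [of "(move I N K)\<^sup>*\<^sup>* l" l "defect I P"] by auto
  then have "minimal I N K P l'" unfolding minimal_def by (meson rtranclp_trans)
  with l'(1) show thesis by (rule that)
qed

locale minimal_labelling =
  fixes I :: "'i set" and N :: "'i \<Rightarrow> 'a set" and K and P and l
  assumes fin: "finite I" and lab: "labelling I N l" and P: "\<And>i. i \<in> I \<Longrightarrow> P i \<in> N i"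
    and K: "\<And>S. S \<in> K \<Longrightarrow> pure I P (l S)" and min: "minimal I N K P l"
begin

lemma code: "cube_code I l"
  using lab by (simp add: labelling_def)

lemma tog_label [simp]: "S \<subseteq> I \<Longrightarrow> i \<in> I \<Longrightarrow> l (tog i S) i = l S i"
  using code by (rule cube_code_tog)

lemma label_in [simp]: "S \<subseteq> I \<Longrightarrow> i \<in> I \<Longrightarrow> l S i \<in> N i"
  using lab by (simp add: labelling_def)

text \<open>Frozen vertices have correct labels only, so an edge with a wrong label is never blocked
  by \<open>K\<close>.\<close>

lemma not_K: "S \<subseteq> I \<Longrightarrow> i \<in> I \<Longrightarrow> l S i \<noteq> P i \<Longrightarrow> S \<notin> K"
  using K by (auto simp: pure_def)

text \<open>Otherwise relabelling the edge by \<open>P i\<close> is a move that lowers the defect by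
  2.\<close>

lemma not_twin:
  assumes "S \<subseteq> I" "i \<in> I" "l S i \<noteq> P i"
  shows "\<not> twin I l S i"
proof
  assume tw: "twin I l S i"
  have "S \<notin> K" "tog i S \<notin> K" using not_K [of S i] not_K [of "tog i S" i] assms by simp_all
  then have "move I N K l (relabel l S i (P i))"
    using tw P assms(2) by (auto simp: move_def)
  then have "defect I P l \<le> defect I P (relabel l S i (P i))"
    using min by (auto simp: minimal_def)
  with defect_relabel [of I S i l P "P i"] assms fin show False by simp
qed

text \<open>In the next two lemmas a twin pair is flipped, possibly at a loss of 2, in such a way that
  two further flips, each of them winning 2, become available.\<close>

lemma two_gains_opposite:
  assumes p: "p \<subseteq> I" and I: "x \<in> I" "y \<in> I" "z \<in> I" and xyz: "x \<noteq> y" "x \<noteq> z" "y \<noteq> z"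
    and eqs: "r = tog x p" "q = tog y p" "t = tog z r"
    and tw: "twin I l p x"
    and pq: "\<And>j. j \<in> I \<Longrightarrow> j \<noteq> x \<Longrightarrow> j \<noteq> y \<Longrightarrow> l p j = l q j"
    and rt: "\<And>j. j \<in> I \<Longrightarrow> j \<noteq> x \<Longrightarrow> j \<noteq> z \<Longrightarrow> l r j = l t j"
    and qt: "l q x = l t x" and py: "l p y \<noteq> P y" and rz: "l r z \<noteq> P z"
  shows False
proof -
  have sub [simp]: "r \<subseteq> I" "q \<subseteq> I" "t \<subseteq> I" using p I by (simp_all add: eqs)
  have ne [simp]: "r \<noteq> p" "q \<noteq> p" "q \<noteq> r" "t \<noteq> p" "t \<noteq> r" "t \<noteq> q" "p \<noteq> r" "p \<noteq> q" "r \<noteq> q"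
      "p \<noteq> t" "r \<noteq> t" "q \<noteq> t"
    using xyz by (auto simp: eqs tog_def set_eq_iff)
  \<comment> \<open>Each of the four vertices has a wrong label: \<open>p\<close> and its neighbour
    \<open>q\<close> in direction \<open>y\<close>, \<open>r\<close> and its neighbour
    \<open>t\<close> in direction \<open>z\<close>.\<close>
  have K': "p \<notin> K" "r \<notin> K" "q \<notin> K" "t \<notin> K"
    using not_K [OF p I(2) py] not_K [OF sub(1) I(3) rz] not_K [of q y] not_K [of t z] p I py rz sub
    by (auto simp: eqs)
  \<comment> \<open>With the label \<open>l q x\<close> on the edge \<open>p r\<close>, the vertex
    \<open>p\<close> agrees with \<open>q\<close> outside \<open>y\<close>; as
    \<open>l q x = l t x\<close>, also \<open>r\<close> agrees with \<open>t\<close> outside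
    \<open>z\<close>. Both of these edges then get their correct labels. The balance is at most 2 -
    2 - 2.\<close>
  define l1 where "l1 = relabel l p x (l q x)"
  define l2 where "l2 = relabel l1 p y (P y)"
  define l3 where "l3 = relabel l2 r z (P z)"
  have tgs: "tog x p = r" "tog y p = q" "tog z r = t" by (simp_all add: eqs)
  have m1: "move I N K l l1"
    unfolding move_def l1_def using tw K' I by (intro exI [of _ p] exI [of _ x] exI [of _ "l q x"]) (simp add: tgs)
  have tw2: "twin I l1 p y"
    unfolding twin_def tgs using p I xyz pq by (auto simp: l1_def relabel_def tgs)
  have m2: "move I N K l1 l2"
    unfolding move_def l2_def using tw2 K' I P by (intro exI [of _ p] exI [of _ y] exI [of _ "P y"]) (simp add: tgs)
  have tw3: "twin I l2 r z"
    unfolding twin_def tgs using p I xyz rt qt by (auto simp: l1_def l2_def relabel_def tgs)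
  have m3: "move I N K l2 l3"
    unfolding move_def l3_def using tw3 K' I P by (intro exI [of _ r] exI [of _ z] exI [of _ "P z"]) (simp add: tgs)
  have "(move I N K)\<^sup>*\<^sup>* l l3" using m1 m2 m3 by (meson r_into_rtranclp rtranclp_trans)
  then have "defect I P l \<le> defect I P l3" using min by (simp add: minimal_def)
  moreover have "defect I P l1 \<le> defect I P l + 2"
    using defect_relabel [of I p x l P "l q x"] fin p I by (auto simp: l1_def of_bool_def split: if_splits)
  moreover have "defect I P l2 + 2 = defect I P l1"
  proof -
    have "l1 (tog y p) y = l1 p y" "l1 p y \<noteq> P y"
      using p I xyz py by (auto simp: l1_def)
    then show ?thesis using defect_relabel [of I p y l1 P "P y"] fin p I by (simp add: l2_def)
  qed
  moreover have "defect I P l3 + 2 = defect I P l2"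
  proof -
    have "l2 (tog z r) z = l2 r z" "l2 r z \<noteq> P z"
      using p I xyz rz sub by (auto simp: l1_def l2_def)
    then show ?thesis using defect_relabel [of I r z l2 P "P z"] fin p I by (simp add: l3_def)
  qed
  ultimately show False by linarith
qed

lemma two_gains_adjacent:
  assumes p: "p \<subseteq> I" and I: "x \<in> I" "y \<in> I" "z \<in> I" and xyz: "x \<noteq> y" "x \<noteq> z" "y \<noteq> z"
    and eqs: "r = tog x p" "q = tog y p" "t = tog z p"
    and tw: "twin I l p x"
    and pq: "\<And>j. j \<in> I \<Longrightarrow> j \<noteq> x \<Longrightarrow> j \<noteq> y \<Longrightarrow> l p j = l q j"
    and pt: "\<And>j. j \<in> I \<Longrightarrow> j \<noteq> x \<Longrightarrow> j \<noteq> y \<Longrightarrow> j \<noteq> z \<Longrightarrow> l p j = l t j"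
    and qt: "l q x = l t x" and ty: "l t y = P y" and py: "l p y \<noteq> P y" and pz: "l p z \<noteq> P z"
  shows False
proof -
  have sub [simp]: "r \<subseteq> I" "q \<subseteq> I" "t \<subseteq> I" using p I by (simp_all add: eqs)
  have ne [simp]: "r \<noteq> p" "q \<noteq> p" "q \<noteq> r" "t \<noteq> p" "t \<noteq> r" "t \<noteq> q" "p \<noteq> r" "p \<noteq> q" "r \<noteq> q"
      "p \<noteq> t" "r \<noteq> t" "q \<noteq> t"
    using xyz by (auto simp: eqs)
  \<comment> \<open>\<open>r\<close> inherits the wrong label of \<open>p\<close> through the twin
    condition, which shows that it is not frozen.\<close>
  have "l r y \<noteq> P y" using tw py I xyz by (simp add: twin_def eqs)
  then have K': "p \<notin> K" "r \<notin> K" "q \<notin> K" "t \<notin> K"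
    using not_K [OF p I(2) py] not_K [of r y] not_K [of q y] not_K [of t z] p I py pz sub
    by (auto simp: eqs)
  \<comment> \<open>The label \<open>l q x\<close> makes \<open>p\<close> agree with
    \<open>q\<close> outside \<open>y\<close>. Correcting the edge \<open>p q\<close> then gives
    \<open>p\<close> the label \<open>P y\<close>, which is the label of \<open>t\<close> by
    \<open>ty\<close>; as \<open>l q x = l t x\<close>, now \<open>p\<close> and \<open>t\<close>
    agree outside \<open>z\<close>, and this edge is corrected as well.\<close>
  define l1 where "l1 = relabel l p x (l q x)"
  define l2 where "l2 = relabel l1 p y (P y)"
  define l3 where "l3 = relabel l2 p z (P z)"
  have tgs: "tog x p = r" "tog y p = q" "tog z p = t" by (simp_all add: eqs)
  have m1: "move I N K l l1"
    unfolding move_def l1_def using tw K' I by (intro exI [of _ p] exI [of _ x] exI [of _ "l q x"]) (simp add: tgs)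
  have tw2: "twin I l1 p y"
    unfolding twin_def tgs using p I xyz pq by (auto simp: l1_def relabel_def tgs)
  have m2: "move I N K l1 l2"
    unfolding move_def l2_def using tw2 K' I P by (intro exI [of _ p] exI [of _ y] exI [of _ "P y"]) (simp add: tgs)
  have tw3: "twin I l2 p z"
    unfolding twin_def tgs using p I xyz pt qt ty by (auto simp: l1_def l2_def relabel_def tgs)
  have m3: "move I N K l2 l3"
    unfolding move_def l3_def using tw3 K' I P by (intro exI [of _ p] exI [of _ z] exI [of _ "P z"]) (simp add: tgs)
  have "(move I N K)\<^sup>*\<^sup>* l l3" using m1 m2 m3 by (meson r_into_rtranclp rtranclp_trans)
  then have "defect I P l \<le> defect I P l3" using min by (simp add: minimal_def)
  moreover have "defect I P l1 \<le> defect I P l + 2"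
    using defect_relabel [of I p x l P "l q x"] fin p I by (auto simp: l1_def of_bool_def split: if_splits)
  moreover have "defect I P l2 + 2 = defect I P l1"
  proof -
    have "l1 (tog y p) y = l1 p y" "l1 p y \<noteq> P y"
      using p I xyz py by (auto simp: l1_def)
    then show ?thesis using defect_relabel [of I p y l1 P "P y"] fin p I by (simp add: l2_def)
  qed
  moreover have "defect I P l3 + 2 = defect I P l2"
  proof -
    have "l2 (tog z p) z = l2 p z" "l2 p z \<noteq> P z"
      using p I xyz pz by (auto simp: l1_def l2_def)
    then show ?thesis using defect_relabel [of I p z l2 P "P z"] fin p I by (simp add: l3_def)
  qed
  ultimately show False by linarith
qed

end

section \<open>Minimal labellings near a pure vertex\<close>

text \<open>In \<open>stuck ds L Q\<close> the labels \<open>L x v\<close> of an edge in direction \<open>x\<close> are only looked up at its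
  end \<open>v = foot x w\<close> with coordinate \<open>False\<close>, so that both ends literally share one term.\<close>

datatype dir = D1 | D2 | D3 | D4 | D5

type_synonym vertex = "bool \<times> bool \<times> bool \<times> bool \<times> bool"

text \<open>The bits of \<open>n\<close> are the coordinates, so \<open>vx 1\<close>,
  \<open>vx 2\<close>, \<open>vx 4\<close>, \<open>vx 8\<close> are the neighbours of
  \<open>vx 0\<close> in the directions \<open>D1\<close> to \<open>D4\<close>. The instance lists
  below use this numbering.\<close>

definition vx :: "nat \<Rightarrow> vertex" where
  "vx n = (odd n, odd (n div 2), odd (n div 4), odd (n div 8), odd (n div 16))"

fun coord :: "dir \<Rightarrow> vertex \<Rightarrow> bool" where
  "coord D1 (a, b, c, d, e) = a"
| "coord D2 (a, b, c, d, e) = b"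
| "coord D3 (a, b, c, d, e) = c"
| "coord D4 (a, b, c, d, e) = d"
| "coord D5 (a, b, c, d, e) = e"

fun nbr :: "dir \<Rightarrow> vertex \<Rightarrow> vertex" where
  "nbr D1 (a, b, c, d, e) = (\<not> a, b, c, d, e)"
| "nbr D2 (a, b, c, d, e) = (a, \<not> b, c, d, e)"
| "nbr D3 (a, b, c, d, e) = (a, b, \<not> c, d, e)"
| "nbr D4 (a, b, c, d, e) = (a, b, c, \<not> d, e)"
| "nbr D5 (a, b, c, d, e) = (a, b, c, d, \<not> e)"

fun foot :: "dir \<Rightarrow> vertex \<Rightarrow> vertex" where
  "foot D1 (a, b, c, d, e) = (False, b, c, d, e)"
| "foot D2 (a, b, c, d, e) = (a, False, c, d, e)"
| "foot D3 (a, b, c, d, e) = (a, b, False, d, e)"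
| "foot D4 (a, b, c, d, e) = (a, b, c, False, e)"
| "foot D5 (a, b, c, d, e) = (a, b, c, d, False)"

definition agree :: "dir list \<Rightarrow> (dir \<Rightarrow> vertex \<Rightarrow> 'a) \<Rightarrow> dir list \<Rightarrow> vertex \<Rightarrow> vertex \<Rightarrow> bool" where
  "agree ds L A v w \<longleftrightarrow> list_all (\<lambda>x. x \<in> set A \<or> L x (foot x v) = L x (foot x w)) ds"

text \<open>The cube code condition for \<open>v\<close> and \<open>w\<close>. Vertices that agree
  in all directions of \<open>ds\<close> count as equal, so the remaining coordinates are
  irrelevant.\<close>

definition stuckX :: "dir list \<Rightarrow> (dir \<Rightarrow> vertex \<Rightarrow> 'a) \<Rightarrow> vertex \<Rightarrow> vertex \<Rightarrow> bool" where
  "stuckX ds L v w \<longleftrightarrow> list_all (\<lambda>x. coord x v = coord x w) ds \<or>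
     list_ex (\<lambda>x. coord x v \<noteq> coord x w \<and> L x (foot x v) = L x (foot x w)) ds"

definition stuckF :: "dir list \<Rightarrow> (dir \<Rightarrow> vertex \<Rightarrow> 'a) \<Rightarrow> (dir \<Rightarrow> 'a) \<Rightarrow> vertex \<Rightarrow> dir \<Rightarrow> bool" where
  "stuckF ds L Q v x \<longleftrightarrow> L x (foot x v) = Q x \<or> \<not> agree ds L [x] v (nbr x v)"

text \<open>The negated hypotheses of \<open>two_gains_adjacent\<close>: after a flip of
  \<open>p r\<close> the edges \<open>p q\<close> and \<open>p t\<close> would both be
  corrected.\<close>

definition stuckH2 :: "dir list \<Rightarrow> (dir \<Rightarrow> vertex \<Rightarrow> 'a) \<Rightarrow> (dir \<Rightarrow> 'a) \<Rightarrow>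
    vertex \<Rightarrow> vertex \<Rightarrow> vertex \<Rightarrow> vertex \<Rightarrow> dir \<Rightarrow> dir \<Rightarrow> dir \<Rightarrow> bool" where
  "stuckH2 ds L Q p r q t x y z \<longleftrightarrow> L y (foot y p) = Q y \<or> L z (foot z p) = Q z \<or>
     L y (foot y t) \<noteq> Q y \<or> L x (foot x q) \<noteq> L x (foot x t) \<or>
     \<not> agree ds L [x] p r \<or> \<not> agree ds L [x, y] p q \<or> \<not> agree ds L [x, y, z] p t"

text \<open>The negated hypotheses of \<open>two_gains_opposite\<close>: after a flip of
  \<open>p r\<close> the edges \<open>p q\<close> and \<open>r t\<close> would both be
  corrected.\<close>

definition stuckH3 :: "dir list \<Rightarrow> (dir \<Rightarrow> vertex \<Rightarrow> 'a) \<Rightarrow> (dir \<Rightarrow> 'a) \<Rightarrow>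
    vertex \<Rightarrow> vertex \<Rightarrow> vertex \<Rightarrow> vertex \<Rightarrow> dir \<Rightarrow> dir \<Rightarrow> dir \<Rightarrow> bool" where
  "stuckH3 ds L Q p r q t x y z \<longleftrightarrow> L y (foot y p) = Q y \<or> L z (foot z r) = Q z \<or>
     L x (foot x q) \<noteq> L x (foot x t) \<or>
     \<not> agree ds L [x] p r \<or> \<not> agree ds L [x, y] p q \<or> \<not> agree ds L [x, z] r t"

text \<open>The conjuncts are the cube code condition, the absence of a single winning flip, the
  absence of the two double gains, and a wrong label in every direction.\<close>

definition stuck :: "dir list \<Rightarrow> (dir \<Rightarrow> vertex \<Rightarrow> 'a) \<Rightarrow> (dir \<Rightarrow> 'a) \<Rightarrow> bool" where
  "stuck ds L Q \<longleftrightarrow> (\<forall>v w. stuckX ds L v w) \<and> (\<forall>v. \<forall>x\<in>set ds. stuckF ds L Q v x) \<and>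
     (\<forall>v. \<forall>x\<in>set ds. \<forall>y\<in>set ds. \<forall>z\<in>set ds. distinct [x, y, z] \<longrightarrow>
        stuckH2 ds L Q v (nbr x v) (nbr y v) (nbr z v) x y z \<and>
        stuckH3 ds L Q v (nbr x v) (nbr y v) (nbr z (nbr x v)) x y z) \<and>
     (\<forall>x\<in>set ds. \<exists>v. L x (foot x v) \<noteq> Q x)"

text \<open>Replaces the quantified conditions by finite conjunctions over given lists, so that each
  use below becomes a ground problem about equalities of labels.\<close>

lemma stuck_instances:
  assumes "stuck ds L Q"
    and fs: "list_all (\<lambda>(p, x). x \<in> set ds) fs"
    and h2s: "list_all (\<lambda>(p, x, y, z). x \<in> set ds \<and> y \<in> set ds \<and> z \<in> set ds \<and> distinct [x, y, z]) h2s"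
    and h3s: "list_all (\<lambda>(p, x, y, z). x \<in> set ds \<and> y \<in> set ds \<and> z \<in> set ds \<and> distinct [x, y, z]) h3s"
  shows "list_all (\<lambda>(p, q). stuckX ds L (vx p) (vx q)) xs \<and>
    list_all (\<lambda>(p, x). stuckF ds L Q (vx p) x) fs \<and>
    list_all (\<lambda>(p, x, y, z).
      stuckH2 ds L Q (vx p) (nbr x (vx p)) (nbr y (vx p)) (nbr z (vx p)) x y z) h2s \<and>
    list_all (\<lambda>(p, x, y, z).
      stuckH3 ds L Q (vx p) (nbr x (vx p)) (nbr y (vx p)) (nbr z (nbr x (vx p))) x y z) h3s"
proof -
  have X: "stuckX ds L v w" for v w
    using assms(1) by (simp only: stuck_def)
  have F: "stuckF ds L Q v x" if "x \<in> set ds" for v x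
    using assms(1) that by (simp only: stuck_def)
  have H: "stuckH2 ds L Q v (nbr x v) (nbr y v) (nbr z v) x y z \<and>
      stuckH3 ds L Q v (nbr x v) (nbr y v) (nbr z (nbr x v)) x y z"
    if "x \<in> set ds" "y \<in> set ds" "z \<in> set ds" "distinct [x, y, z]" for v x y z
    using assms(1) that by (simp only: stuck_def)
  show ?thesis
  proof (intro conjI)
    show "list_all (\<lambda>(p, q). stuckX ds L (vx p) (vx q)) xs"
      by (induction xs) (auto simp: X)
    show "list_all (\<lambda>(p, x). stuckF ds L Q (vx p) x) fs"
      using fs by (induction fs) (auto simp: F)
    show "list_all (\<lambda>(p, x, y, z).
      stuckH2 ds L Q (vx p) (nbr x (vx p)) (nbr y (vx p)) (nbr z (vx p)) x y z) h2s"
      using h2s by (induction h2s) (auto simp: H)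
    show "list_all (\<lambda>(p, x, y, z).
      stuckH3 ds L Q (vx p) (nbr x (vx p)) (nbr y (vx p)) (nbr z (nbr x (vx p))) x y z) h3s"
      using h3s by (induction h3s) (auto simp: H)
  qed
qed

text \<open>Spelled out over single coordinates so that \<open>ex_bool_eq\<close> can turn it into a
  finite disjunction in \<open>five_dirs_3\<close>.\<close>

lemma stuck_nonconst:
  assumes "stuck ds L Q" "D1 \<in> set ds"
  shows "\<exists>b c d e. L D1 (False, b, c, d, e) \<noteq> Q D1"
proof -
  obtain v where "L D1 (foot D1 v) \<noteq> Q D1" using assms by (auto simp: stuck_def)
  then show ?thesis by (cases v) auto
qed

lemmas stuck_eval = vx_def stuckX_def stuckF_def stuckH2_def stuckH3_def agree_def

text \<open>In the next lemmas \<open>vx 0\<close> is a pure vertex. The lists are unsatisfiable cores, found with a SAT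
  solver; the functions \<open>M1\<close>, \<dots>, \<open>M5\<close> only hide the tuples from the final propositional step. In
  \<open>five_dirs_k\<close> the neighbour \<open>vx 1\<close> of \<open>vx 0\<close> has exactly \<open>k\<close> labels different from \<open>Q\<close>.\<close>

lemma two_dirs:
  assumes "stuck [D1, D2] L Q"
    and "L D2 (foot D2 (vx 0)) = Q D2"
    and "\<forall>x\<in>{D2}. L x (foot x (vx 1)) \<noteq> Q x"
  shows False
proof -
  from stuck_instances [OF assms(1), where
    xs = "[(1, 2)]" and
    fs = "[(1, D2)]" and
    h2s = "[]" and
    h3s = "[]"]
    assms(2-3)
  show False
    by (simp add: stuck_eval)
qed

lemma three_dirs:
  assumes "stuck [D1, D2, D3] L Q"
    and "\<forall>x\<in>{D1, D2, D3}. L x (foot x (vx 0)) = Q x"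
    and "\<forall>x\<in>{D2}. L x (foot x (vx 1)) \<noteq> Q x"
  shows False
proof -
  define M1 where "M1 = (\<lambda>a b c d e. L D1 (a, b, c, d, e))"
  define M2 where "M2 = (\<lambda>a b c d e. L D2 (a, b, c, d, e))"
  define M3 where "M3 = (\<lambda>a b c d e. L D3 (a, b, c, d, e))"
  have L: "L D1 (a, b, c, d, e) = M1 a b c d e"
    "L D2 (a, b, c, d, e) = M2 a b c d e"
    "L D3 (a, b, c, d, e) = M3 a b c d e" for a b c d e
    by (simp_all only: M1_def M2_def M3_def)
  from stuck_instances [OF assms(1), where
    xs = "[(0, 7), (1, 2), (1, 4), (1, 7), (3, 4)]" and
    fs = "[(1, D3), (3, D2), (3, D3), (4, D1)]" and
    h2s = "[]" and
    h3s = "[]"]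
    assms(2-3)
  show False
    by (simp add: stuck_eval L) (smt (z3))
qed

lemma four_dirs:
  assumes "stuck [D1, D2, D3, D4] L Q"
    and "\<forall>x\<in>{D1, D2, D3, D4}. L x (foot x (vx 0)) = Q x"
    and "\<forall>x\<in>{D2}. L x (foot x (vx 1)) \<noteq> Q x"
  shows False
proof -
  define M1 where "M1 = (\<lambda>a b c d e. L D1 (a, b, c, d, e))"
  define M2 where "M2 = (\<lambda>a b c d e. L D2 (a, b, c, d, e))"
  define M3 where "M3 = (\<lambda>a b c d e. L D3 (a, b, c, d, e))"
  define M4 where "M4 = (\<lambda>a b c d e. L D4 (a, b, c, d, e))"
  have L: "L D1 (a, b, c, d, e) = M1 a b c d e"
    "L D2 (a, b, c, d, e) = M2 a b c d e"
    "L D3 (a, b, c, d, e) = M3 a b c d e"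
    "L D4 (a, b, c, d, e) = M4 a b c d e" for a b c d e
    by (simp_all only: M1_def M2_def M3_def M4_def)
  from stuck_instances [OF assms(1), where
    xs = "[(0, 7), (0, 11), (0, 13), (0, 15), (1, 2), (1, 4), (1, 7), (1, 8), (1, 11), (1, 13),
          (1, 15), (3, 6), (3, 8), (3, 13), (4, 13), (5, 6), (5, 11), (5, 15), (7, 9), (7, 11),
          (7, 14), (9, 12)]" and
    fs = "[(1, D2), (1, D3), (1, D4), (4, D1), (5, D4), (7, D1), (7, D3), (7, D4), (8, D1), (11,
          D3), (11, D4), (13, D3)]" and
    h2s = "[(1, D4, D3, D2)]" and
    h3s = "[(1, D3, D4, D2), (3, D3, D2, D4), (5, D2, D3, D4), (5, D3, D4, D2), (9, D4, D3, D2)]"]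
    assms(2-3)
  show False
    by (simp add: stuck_eval L) (smt (z3))
qed

lemma five_dirs_1:
  assumes "stuck [D1, D2, D3, D4, D5] L Q"
    and "\<forall>x\<in>{D1, D2, D3, D4, D5}. L x (foot x (vx 0)) = Q x"
    and "\<forall>x\<in>{D2}. L x (foot x (vx 1)) \<noteq> Q x"
    and "\<forall>x\<in>{D1, D3, D4, D5}. L x (foot x (vx 1)) = Q x"
  shows False
proof -
  define M1 where "M1 = (\<lambda>a b c d e. L D1 (a, b, c, d, e))"
  define M2 where "M2 = (\<lambda>a b c d e. L D2 (a, b, c, d, e))"
  define M3 where "M3 = (\<lambda>a b c d e. L D3 (a, b, c, d, e))"
  define M4 where "M4 = (\<lambda>a b c d e. L D4 (a, b, c, d, e))"
  define M5 where "M5 = (\<lambda>a b c d e. L D5 (a, b, c, d, e))"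
  have L: "L D1 (a, b, c, d, e) = M1 a b c d e"
    "L D2 (a, b, c, d, e) = M2 a b c d e"
    "L D3 (a, b, c, d, e) = M3 a b c d e"
    "L D4 (a, b, c, d, e) = M4 a b c d e"
    "L D5 (a, b, c, d, e) = M5 a b c d e" for a b c d e
    by (simp_all only: M1_def M2_def M3_def M4_def M5_def)
  from stuck_instances [OF assms(1), where
    xs = "[(0, 3), (0, 7), (0, 11), (0, 14), (0, 15), (0, 19), (0, 20), (0, 22), (0, 23), (0, 26),
          (0, 27), (0, 28), (0, 30), (0, 31), (1, 7), (1, 15), (1, 23), (1, 27), (1, 29), (1, 31),
          (2, 5), (2, 7), (2, 8), (3, 9), (3, 10), (3, 15), (3, 17), (3, 18), (3, 23), (3, 31),
          (4, 7), (4, 8), (4, 11), (4, 19), (4, 29), (5, 9), (5, 11), (5, 14), (5, 17), (5, 19),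
          (5, 22), (5, 23), (5, 27), (5, 30), (5, 31), (6, 13), (6, 19), (6, 21), (6, 23), (6,
          30), (6, 31), (7, 8), (7, 10), (7, 12), (7, 13), (7, 14), (7, 16), (7, 17), (7, 20), (7,
          27), (7, 30), (8, 16), (8, 19), (9, 10), (9, 14), (9, 17), (9, 23), (9, 26), (9, 30),
          (9, 31), (10, 13), (10, 15), (10, 25), (10, 27), (10, 30), (11, 12), (11, 13), (11, 16),
          (11, 17), (11, 19), (11, 23), (11, 24), (11, 25), (11, 28), (12, 15), (12, 20), (12,
          23), (12, 24), (12, 27), (12, 29), (12, 31), (13, 23), (13, 27), (13, 30), (13, 31),
          (14, 23), (14, 27), (14, 29), (15, 19), (15, 20), (15, 23), (15, 24), (15, 25), (15,
          26), (15, 27), (15, 28), (15, 30), (16, 19), (16, 31), (17, 20), (17, 22), (17, 26),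
          (17, 31), (18, 21), (18, 25), (18, 30), (18, 31), (19, 20), (19, 22), (19, 24), (19,
          26), (19, 28), (20, 24), (20, 31), (21, 22), (21, 27), (21, 28), (21, 31), (22, 29),
          (23, 27), (23, 28), (23, 30), (24, 27), (24, 31), (25, 30), (26, 29), (27, 28), (27,
          29), (27, 30), (28, 31)]" and
    fs = "[(1, D2), (3, D3), (3, D4), (6, D1), (11, D1), (15, D1), (15, D3), (15, D4), (15, D5),
          (18, D1), (19, D3), (19, D5), (23, D1), (23, D5), (26, D1), (27, D4), (27, D5), (29,
          D2), (31, D1), (31, D3), (31, D4)]" and
    h2s = "[(3, D4, D3, D5), (3, D4, D5, D3), (3, D5, D3, D4), (3, D5, D4, D3), (7, D4, D5, D3),
           (7, D5, D4, D3), (11, D3, D5, D4), (11, D5, D3, D4), (14, D2, D1, D3), (14, D2, D1,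
           D4), (14, D2, D1, D5), (19, D3, D4, D5), (19, D4, D3, D5), (23, D3, D4, D5), (27, D4,
           D3, D5), (27, D5, D3, D4), (30, D2, D1, D3), (30, D2, D1, D4), (30, D2, D1, D5)]" and
    h3s = "[(3, D3, D5, D4), (6, D2, D1, D4), (6, D2, D1, D5), (7, D3, D5, D4), (7, D4, D3, D5),
           (7, D5, D3, D4), (10, D2, D1, D3), (10, D2, D1, D5), (11, D3, D4, D5), (16, D2, D4,
           D1), (18, D2, D1, D3), (20, D2, D3, D1), (20, D2, D4, D1), (20, D2, D5, D1), (24, D2,
           D3, D1), (26, D2, D1, D4), (26, D2, D1, D5), (31, D3, D4, D5), (31, D3, D5, D4), (31,
           D4, D3, D5), (31, D4, D5, D3), (31, D5, D3, D4), (31, D5, D4, D3)]"]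
    assms(2-4)
  show False
    by (simp add: stuck_eval L) (smt (z3))
qed

lemma five_dirs_2:
  assumes "stuck [D1, D2, D3, D4, D5] L Q"
    and "\<forall>x\<in>{D1, D2, D3, D4, D5}. L x (foot x (vx 0)) = Q x"
    and "\<forall>x\<in>{D2, D3}. L x (foot x (vx 1)) \<noteq> Q x"
    and "\<forall>x\<in>{D1, D4, D5}. L x (foot x (vx 1)) = Q x"
  shows False
proof -
  define M1 where "M1 = (\<lambda>a b c d e. L D1 (a, b, c, d, e))"
  define M2 where "M2 = (\<lambda>a b c d e. L D2 (a, b, c, d, e))"
  define M3 where "M3 = (\<lambda>a b c d e. L D3 (a, b, c, d, e))"
  define M4 where "M4 = (\<lambda>a b c d e. L D4 (a, b, c, d, e))"
  define M5 where "M5 = (\<lambda>a b c d e. L D5 (a, b, c, d, e))"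
  have L: "L D1 (a, b, c, d, e) = M1 a b c d e"
    "L D2 (a, b, c, d, e) = M2 a b c d e"
    "L D3 (a, b, c, d, e) = M3 a b c d e"
    "L D4 (a, b, c, d, e) = M4 a b c d e"
    "L D5 (a, b, c, d, e) = M5 a b c d e" for a b c d e
    by (simp_all only: M1_def M2_def M3_def M4_def M5_def)
  from stuck_instances [OF assms(1), where
    xs = "[(0, 3), (0, 5), (0, 7), (0, 11), (0, 13), (0, 15), (0, 19), (0, 21), (0, 23), (0, 27),
          (0, 29), (0, 31), (1, 7), (1, 15), (1, 23), (1, 27), (1, 29), (1, 31), (2, 7), (3, 9),
          (3, 13), (3, 14), (3, 15), (3, 17), (3, 22), (3, 23), (3, 29), (3, 30), (3, 31), (4, 7),
          (5, 9), (5, 11), (5, 14), (5, 17), (5, 22), (5, 23), (5, 31), (6, 11), (6, 23), (7, 9),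
          (7, 13), (7, 14), (7, 27), (7, 29), (10, 15), (11, 13), (11, 19), (11, 21), (11, 22),
          (11, 23), (12, 15), (13, 19), (13, 21), (13, 23), (13, 27), (13, 30), (13, 31), (14,
          19), (14, 27), (15, 19), (15, 21), (15, 23), (15, 27), (15, 30), (17, 23), (19, 22),
          (19, 30), (21, 22), (21, 27), (21, 30), (21, 31), (22, 27), (23, 27), (23, 30), (27,
          29), (27, 30), (28, 31)]" and
    fs = "[(1, D2), (3, D3), (3, D4), (5, D2), (5, D3), (5, D5), (6, D1), (6, D4), (6, D5), (13,
          D4), (13, D5), (15, D1), (15, D2), (15, D3), (15, D4), (19, D3), (19, D5), (21, D2),
          (23, D1), (23, D5), (27, D4), (27, D5), (29, D4), (31, D1), (31, D3)]" and
    h2s = "[(3, D3, D4, D2), (3, D3, D4, D5), (3, D3, D5, D2), (3, D3, D5, D4), (7, D2, D4, D3),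
           (7, D4, D3, D5), (7, D5, D3, D4), (11, D3, D5, D4), (13, D2, D5, D4), (15, D4, D3, D5),
           (19, D3, D4, D5)]" and
    h3s = "[(5, D2, D4, D3), (5, D2, D4, D5), (5, D2, D5, D3), (7, D5, D2, D3), (11, D3, D4, D5),
           (13, D2, D4, D3), (15, D3, D2, D4), (19, D3, D5, D2), (21, D2, D4, D3), (21, D2, D4,
           D5), (21, D2, D5, D3), (23, D3, D4, D5), (27, D3, D4, D2), (29, D2, D5, D3), (31, D2,
           D3, D4), (31, D3, D2, D5), (31, D3, D4, D5), (31, D3, D5, D4)]"]
    assms(2-4)
  show False
    by (simp add: stuck_eval L) (smt (z3))
qed

lemma five_dirs_3:
  assumes "stuck [D1, D2, D3, D4, D5] L Q"
    and "\<forall>x\<in>{D1, D2, D3, D4, D5}. L x (foot x (vx 0)) = Q x"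
    and "\<forall>x\<in>{D2, D3, D4}. L x (foot x (vx 1)) \<noteq> Q x"
    and "\<forall>x\<in>{D1, D5}. L x (foot x (vx 1)) = Q x"
    and "\<forall>x\<in>{D1, D2, D3, D4, D5}. L x (foot x (vx 4)) = Q x"
    and "\<forall>x\<in>{D1, D2, D3, D4, D5}. L x (foot x (vx 8)) = Q x"
  shows False
proof -
  define M1 where "M1 = (\<lambda>a b c d e. L D1 (a, b, c, d, e))"
  define M2 where "M2 = (\<lambda>a b c d e. L D2 (a, b, c, d, e))"
  define M3 where "M3 = (\<lambda>a b c d e. L D3 (a, b, c, d, e))"
  define M4 where "M4 = (\<lambda>a b c d e. L D4 (a, b, c, d, e))"
  define M5 where "M5 = (\<lambda>a b c d e. L D5 (a, b, c, d, e))"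
  have L: "L D1 (a, b, c, d, e) = M1 a b c d e"
    "L D2 (a, b, c, d, e) = M2 a b c d e"
    "L D3 (a, b, c, d, e) = M3 a b c d e"
    "L D4 (a, b, c, d, e) = M4 a b c d e"
    "L D5 (a, b, c, d, e) = M5 a b c d e" for a b c d e
    by (simp_all only: M1_def M2_def M3_def M4_def M5_def)
  \<comment> \<open>In this case the existence of a wrong label in direction \<open>D1\<close> is
    supplied as a further premise.\<close>
  from stuck_instances [OF assms(1), where
    xs = "[(0, 3), (0, 19), (0, 21), (1, 11), (1, 12), (1, 13), (1, 23), (1, 27), (1, 29), (2, 7),
          (3, 5), (3, 10), (3, 13), (3, 15), (3, 17), (3, 21), (3, 22), (3, 23), (3, 25), (3, 29),
          (3, 31), (4, 15), (4, 23), (4, 29), (4, 31), (5, 6), (5, 10), (5, 11), (5, 15), (5, 16),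
          (5, 17), (5, 19), (5, 20), (5, 23), (5, 25), (5, 27), (5, 29), (5, 31), (6, 9), (6, 15),
          (7, 9), (7, 16), (7, 17), (7, 22), (7, 27), (7, 29), (7, 31), (8, 11), (8, 15), (8, 27),
          (8, 29), (8, 31), (9, 17), (9, 19), (9, 21), (9, 22), (9, 23), (9, 24), (9, 27), (9,
          31), (11, 13), (11, 14), (11, 17), (11, 19), (11, 23), (11, 26), (11, 29), (11, 31),
          (13, 16), (13, 17), (13, 19), (13, 23), (13, 25), (13, 27), (13, 31), (14, 31), (15,
          19), (15, 21), (15, 25), (16, 25), (17, 18), (17, 23), (17, 27), (18, 23), (18, 27),
          (19, 29), (19, 31), (20, 23), (21, 25), (21, 27), (21, 31), (22, 29), (22, 31), (23,
          25), (23, 26), (24, 27), (26, 29), (26, 31), (27, 29), (29, 30)]" and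
    fs = "[(1, D2), (1, D4), (5, D3), (5, D5), (7, D1), (7, D2), (7, D3), (7, D5), (10, D1), (11,
          D2), (11, D4), (13, D3), (13, D4), (17, D1), (19, D3), (19, D5), (21, D4), (23, D1),
          (25, D5), (27, D1), (27, D4), (27, D5), (29, D3), (29, D5), (30, D1)]" and
    h2s = "[(1, D5, D3, D2), (1, D5, D4, D2), (3, D3, D5, D2), (3, D4, D5, D2), (5, D2, D5, D3),
           (5, D4, D3, D2), (5, D4, D5, D3), (7, D2, D3, D5), (9, D2, D5, D4), (9, D3, D4, D2),
           (9, D3, D5, D4), (13, D3, D4, D5), (13, D4, D3, D5), (19, D3, D5, D2), (19, D4, D5,
           D2), (21, D4, D5, D3), (25, D3, D5, D4)]" and
    h3s = "[(1, D5, D4, D2), (1, D5, D4, D3), (3, D3, D4, D2), (11, D2, D4, D3), (11, D4, D2, D3),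
           (17, D5, D2, D3), (17, D5, D3, D2), (17, D5, D4, D2), (17, D5, D4, D3), (19, D3, D5,
           D4), (19, D4, D5, D2), (21, D2, D5, D4), (21, D4, D5, D2), (23, D2, D3, D5), (23, D3,
           D2, D5), (25, D3, D5, D2), (25, D3, D5, D4), (27, D2, D3, D5), (27, D2, D4, D5), (27,
           D4, D3, D5), (29, D4, D3, D5)]"]
    assms(2-6) stuck_nonconst [OF assms(1)]
  show False
    by (simp add: stuck_eval L ex_bool_eq) (smt (z3))
qed

lemma five_dirs_4:
  assumes "stuck [D1, D2, D3, D4, D5] L Q"
    and "\<forall>x\<in>{D1, D2, D3, D4, D5}. L x (foot x (vx 0)) = Q x"
    and "\<forall>x\<in>{D2, D3, D4, D5}. L x (foot x (vx 1)) \<noteq> Q x"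
    and "\<forall>x\<in>{D1}. L x (foot x (vx 1)) = Q x"
    and "\<forall>x\<in>{D1, D2, D3, D4, D5}. L x (foot x (vx 2)) = Q x"
    and "\<forall>x\<in>{D1, D2, D3, D4, D5}. L x (foot x (vx 4)) = Q x"
    and "\<forall>x\<in>{D1, D2, D3, D4, D5}. L x (foot x (vx 8)) = Q x"
  shows False
proof -
  define M1 where "M1 = (\<lambda>a b c d e. L D1 (a, b, c, d, e))"
  define M2 where "M2 = (\<lambda>a b c d e. L D2 (a, b, c, d, e))"
  define M3 where "M3 = (\<lambda>a b c d e. L D3 (a, b, c, d, e))"
  define M4 where "M4 = (\<lambda>a b c d e. L D4 (a, b, c, d, e))"
  define M5 where "M5 = (\<lambda>a b c d e. L D5 (a, b, c, d, e))"
  have L: "L D1 (a, b, c, d, e) = M1 a b c d e"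
    "L D2 (a, b, c, d, e) = M2 a b c d e"
    "L D3 (a, b, c, d, e) = M3 a b c d e"
    "L D4 (a, b, c, d, e) = M4 a b c d e"
    "L D5 (a, b, c, d, e) = M5 a b c d e" for a b c d e
    by (simp_all only: M1_def M2_def M3_def M4_def M5_def)
  from stuck_instances [OF assms(1), where
    xs = "[(0, 17), (1, 6), (1, 10), (1, 12), (1, 13), (2, 15), (2, 23), (2, 27), (3, 5), (3, 9),
          (3, 13), (3, 17), (3, 18), (3, 20), (3, 21), (3, 24), (3, 25), (3, 27), (3, 29), (4,
          21), (4, 23), (4, 29), (5, 11), (5, 17), (5, 18), (5, 19), (5, 23), (5, 24), (5, 25),
          (5, 27), (5, 29), (7, 9), (7, 11), (7, 13), (7, 17), (7, 19), (7, 25), (7, 27), (7, 29),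
          (7, 31), (8, 15), (8, 27), (8, 29), (9, 17), (9, 18), (9, 19), (9, 20), (9, 21), (9,
          23), (9, 24), (9, 27), (11, 13), (11, 17), (11, 21), (11, 23), (11, 29), (11, 31), (13,
          17), (13, 19), (13, 23), (13, 25), (13, 27), (15, 17), (15, 19), (15, 21), (15, 29),
          (16, 19), (16, 21), (17, 24), (17, 31), (18, 23), (19, 21), (19, 25), (19, 26), (19,
          29), (19, 31), (20, 29), (21, 22), (21, 25), (21, 27), (23, 25), (23, 29), (24, 27),
          (25, 28), (27, 29)]" and
    fs = "[(1, D2), (1, D3), (3, D3), (5, D2), (9, D2), (9, D4), (11, D4), (13, D3), (13, D4),
          (17, D2), (17, D3), (17, D5), (18, D1), (21, D1), (24, D1), (25, D4)]" and
    h2s = "[(3, D3, D2, D4), (3, D3, D2, D5), (3, D4, D2, D5), (5, D2, D3, D4), (5, D2, D3, D5),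
           (5, D4, D3, D2), (5, D4, D3, D5), (9, D2, D4, D3), (9, D2, D4, D5), (9, D3, D4, D2),
           (9, D3, D4, D5)]" and
    h3s = "[(3, D3, D2, D5), (3, D5, D2, D4), (5, D4, D3, D2), (5, D4, D3, D5), (7, D2, D4, D3),
           (7, D2, D5, D3), (7, D3, D4, D2), (9, D5, D4, D2), (9, D5, D4, D3), (11, D2, D3, D4),
           (11, D2, D5, D4), (11, D4, D3, D2), (11, D4, D5, D2), (13, D3, D2, D4), (13, D3, D5,
           D4), (17, D3, D5, D2), (19, D2, D3, D5), (19, D2, D4, D5), (19, D5, D3, D2), (21, D3,
           D4, D5), (21, D5, D2, D3), (21, D5, D4, D3), (25, D4, D2, D5), (25, D4, D3, D5)]"]
    assms(2-7)
  show False
    by (simp add: stuck_eval L) (smt (z3))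
qed

section \<open>Transfer between the model cube and the cube of subsets\<close>

lemma coord_nbr: "coord y (nbr x v) \<longleftrightarrow> (if y = x then \<not> coord y v else coord y v)"
  by (cases v; cases x; cases y) auto

lemma foot_eq: "foot x v = (if coord x v then nbr x v else v)"
  by (cases v; cases x) auto

lemma vx_simps: "coord x (vx 0) = False"
    "vx 1 = nbr D1 (vx 0)" "vx 2 = nbr D2 (vx 0)" "vx 4 = nbr D3 (vx 0)" "vx 8 = nbr D4 (vx 0)"
  by (cases x; simp add: vx_def) (simp_all add: vx_def)

text \<open>Places the model cube so that its origin \<open>vx 0\<close> lands on \<open>q\<close>:
  a coordinate tells whether the direction has been crossed on the way from \<open>q\<close>. The
  map \<open>e\<close> names the directions, and coordinates outside \<open>ds\<close> are
  ignored.\<close>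

definition corner :: "'i set \<Rightarrow> (dir \<Rightarrow> 'i) \<Rightarrow> dir list \<Rightarrow> vertex \<Rightarrow> 'i set" where
  "corner q e ds v = sym_diff q (e ` {x \<in> set ds. coord x v})"

lemma in_corner:
  "inj_on e (set ds) \<Longrightarrow> x \<in> set ds \<Longrightarrow> e x \<in> corner q e ds v \<longleftrightarrow> (e x \<in> q) \<noteq> coord x v"
  by (auto simp: corner_def dest: inj_onD)

lemma corner_subset: "q \<subseteq> e ` set ds \<Longrightarrow> corner q e ds v \<subseteq> e ` set ds"
  by (auto simp: corner_def)

lemma corner_eqI:
  assumes "inj_on e (set ds)" "q \<subseteq> e ` set ds" "S \<subseteq> e ` set ds"
    and "\<And>x. x \<in> set ds \<Longrightarrow> e x \<in> S \<longleftrightarrow> (e x \<in> q) \<noteq> coord x v"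
  shows "corner q e ds v = S"
proof (rule set_eqI)
  fix i
  show "i \<in> corner q e ds v \<longleftrightarrow> i \<in> S"
  proof (cases "i \<in> e ` set ds")
    case True
    then show ?thesis using in_corner [OF assms(1), of _ q v] assms(4) by auto
  next
    case False
    then show ?thesis using corner_subset [OF assms(2)] assms(3) by blast
  qed
qed

lemma corner_nbr:
  assumes "inj_on e (set ds)" "q \<subseteq> e ` set ds" "x \<in> set ds"
  shows "corner q e ds (nbr x v) = tog (e x) (corner q e ds v)"
proof (rule corner_eqI [OF assms(1,2)])
  show "tog (e x) (corner q e ds v) \<subseteq> e ` set ds"
    using corner_subset [OF assms(2)] assms(3) by simp
  fix y assume y: "y \<in> set ds"
  then have "e y = e x \<longleftrightarrow> y = x" using assms(1,3) by (auto dest: inj_onD)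
  then show "e y \<in> tog (e x) (corner q e ds v) \<longleftrightarrow> (e y \<in> q) \<noteq> coord y (nbr x v)"
    using in_corner [OF assms(1) y, of q v] by (auto simp: in_tog coord_nbr)
qed

lemma corner_0: "corner q e ds (vx 0) = q"
  by (auto simp: corner_def vx_simps)

text \<open>Lets a vertex with a wrong label be found again in the model cube; its coordinates are
  the directions in which it differs from \<open>q\<close>.\<close>

lemma corner_surj:
  assumes "inj_on e (set ds)" "q \<subseteq> e ` set ds" "S \<subseteq> e ` set ds"
  obtains v where "corner q e ds v = S"
proof -
  let ?f = "\<lambda>x. (e x \<in> q) \<noteq> (e x \<in> S)"
  let ?v = "(?f D1, ?f D2, ?f D3, ?f D4, ?f D5)"
  have "coord x ?v \<longleftrightarrow> ?f x" for x by (cases x) simp_all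
  then have "corner q e ds ?v = S"
    by (intro corner_eqI [OF assms]) blast
  then show thesis by (rule that)
qed

context minimal_labelling
begin

text \<open>Brings a minimal labelling into the form that the unsatisfiable cores refute.
  \<open>X\<close> comes from the cube code, \<open>F\<close> from \<open>not_twin\<close>,
  \<open>H2\<close> and \<open>H3\<close> from the two lemmas on double gains, and \<open>C\<close>
  from \<open>nonconst\<close>.\<close>

lemma stuck_corner:
  assumes q: "q \<subseteq> I" and e: "inj_on e (set ds)" "e ` set ds = I"
    and nonconst: "\<And>i. i \<in> I \<Longrightarrow> \<exists>S\<subseteq>I. l S i \<noteq> P i"
  shows "stuck ds (\<lambda>x v. l (corner q e ds v) (e x)) (\<lambda>x. P (e x))"
proof -
  let ?c = "corner q e ds"
  let ?L = "\<lambda>x v. l (?c v) (e x)"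
  have q': "q \<subseteq> e ` set ds" using q e(2) by simp
  have c [simp]: "?c v \<subseteq> I" for v using corner_subset [OF q'] e(2) by simp
  have nbr: "?c (nbr x v) = tog (e x) (?c v)" if "x \<in> set ds" for x v
    using corner_nbr [OF e(1) q' that] .
  have eI [simp]: "e x \<in> I" if "x \<in> set ds" for x using e(2) that by blast
  \<comment> \<open>The two ends of an edge share its label, so looking the label up at the foot
    changes nothing.\<close>
  have foot: "?L x (foot x v) = ?L x v" if "x \<in> set ds" for x v
    using that by (simp add: foot_eq nbr)
  have e_eq: "e x = e y \<longleftrightarrow> x = y" if "x \<in> set ds" "y \<in> set ds" for x y
    using e(1) that by (auto dest: inj_onD)
  have agree: "l (?c v) j = l (?c w) j"
    if a: "agree ds ?L A v w" and j: "j \<in> I" and A: "j \<notin> e ` set A" for A v w j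
  proof -
    obtain x where x: "x \<in> set ds" "j = e x" using j e(2) by blast
    then have "x \<notin> set A" using A by blast
    then have "?L x (foot x v) = ?L x (foot x w)"
      using a x(1) by (auto simp: agree_def list_all_iff)
    then show ?thesis using foot x by simp
  qed
  have X: "stuckX ds ?L v w" for v w
  proof (cases "\<forall>x\<in>set ds. coord x v = coord x w")
    case False
    then have "?c v \<noteq> ?c w" using in_corner [OF e(1)] by metis
    then obtain i where i: "i \<in> I" "i \<in> ?c v \<longleftrightarrow> i \<notin> ?c w" "l (?c v) i = l (?c w) i"
      using code by (metis c cube_codeD)
    then obtain x where x: "x \<in> set ds" "i = e x" using e(2) by blast
    then have "coord x v \<noteq> coord x w" "?L x (foot x v) = ?L x (foot x w)"
      using i in_corner [OF e(1)] foot by auto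
    then show ?thesis using x(1) unfolding stuckX_def list_ex_iff by blast
  qed (simp add: stuckX_def list_all_iff)
  have F: "stuckF ds ?L (\<lambda>x. P (e x)) v x" if x: "x \<in> set ds" for v x
  proof (rule ccontr)
    assume "\<not> stuckF ds ?L (\<lambda>x. P (e x)) v x"
    then have *: "?L x v \<noteq> P (e x)" "agree ds ?L [x] v (nbr x v)"
      using x foot by (auto simp: stuckF_def)
    have "twin I l (?c v) (e x)"
      unfolding twin_def using x agree [OF *(2)] by (auto simp: nbr)
    then show False using not_twin *(1) x by simp
  qed
  have twinI: "twin I l (?c v) (e x)" if "agree ds ?L [x] v (nbr x v)" "x \<in> set ds" for x v
    unfolding twin_def using that agree [OF that(1)] by (auto simp: nbr)
  have H2: "stuckH2 ds ?L (\<lambda>x. P (e x)) v (nbr x v) (nbr y v) (nbr z v) x y z"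
    if xyz: "x \<in> set ds" "y \<in> set ds" "z \<in> set ds" "distinct [x, y, z]" for v x y z
  proof (rule ccontr)
    assume "\<not> ?thesis"
    then have *: "?L y v \<noteq> P (e y)" "?L z v \<noteq> P (e z)" "?L y (nbr z v) = P (e y)"
      "?L x (nbr y v) = ?L x (nbr z v)" "agree ds ?L [x] v (nbr x v)"
      "agree ds ?L [x, y] v (nbr y v)" "agree ds ?L [x, y, z] v (nbr z v)"
      using xyz foot by (auto simp: stuckH2_def)
    show False
      by (rule two_gains_adjacent [of "?c v" "e x" "e y" "e z" "?c (nbr x v)" "?c (nbr y v)" "?c (nbr z v)"])
        (use * xyz e_eq nbr twinI agree [OF *(6)] agree [OF *(7)] in auto)
  qed
  have H3: "stuckH3 ds ?L (\<lambda>x. P (e x)) v (nbr x v) (nbr y v) (nbr z (nbr x v)) x y z"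
    if xyz: "x \<in> set ds" "y \<in> set ds" "z \<in> set ds" "distinct [x, y, z]" for v x y z
  proof (rule ccontr)
    assume "\<not> ?thesis"
    then have *: "?L y v \<noteq> P (e y)" "?L z (nbr x v) \<noteq> P (e z)"
      "?L x (nbr y v) = ?L x (nbr z (nbr x v))" "agree ds ?L [x] v (nbr x v)"
      "agree ds ?L [x, y] v (nbr y v)" "agree ds ?L [x, z] (nbr x v) (nbr z (nbr x v))"
      using xyz foot by (auto simp: stuckH3_def)
    show False
      by (rule two_gains_opposite [of "?c v" "e x" "e y" "e z" "?c (nbr x v)" "?c (nbr y v)" "?c (nbr z (nbr x v))"])
        (use * xyz e_eq nbr twinI agree [OF *(5)] agree [OF *(6)] in auto)
  qed
  have C: "\<exists>v. ?L x (foot x v) \<noteq> P (e x)" if x: "x \<in> set ds" for x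
  proof -
    obtain S where S: "S \<subseteq> I" "l S (e x) \<noteq> P (e x)" using nonconst x by (meson eI)
    obtain v where "?c v = S" using corner_surj [OF e(1) q'] S(1) e(2) by metis
    then show ?thesis using S(2) foot x by metis
  qed
  show ?thesis unfolding stuck_def using X F H2 H3 C by blast
qed

text \<open>Compare \<open>q\<close> with the opposite corner of the square spanned by the
  directions \<open>i\<close> and \<open>j\<close>. They must share a label in one of these
  directions; in direction \<open>j\<close> that corner has the wrong label of
  \<open>tog i q\<close>, so it is correct in direction \<open>i\<close>. Hence there are no
  opposite arcs.\<close>

lemma oriented:
  assumes q: "q \<subseteq> I" "pure I P (l q)" and ij: "i \<in> I" "j \<in> I" and A: "l (tog i q) j \<noteq> P j"
  shows "l (tog j q) i = P i"
proof -
  have Pq: "l q k = P k" if "k \<in> I" for k using q(2) that by (simp add: pure_def)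
  have "i \<noteq> j" using A q ij Pq by auto
  let ?w = "tog i (tog j q)"
  have "i \<in> ?w \<longleftrightarrow> i \<notin> q" using \<open>i \<noteq> j\<close> by (simp add: in_tog)
  then have "?w \<subseteq> I" "q \<noteq> ?w" using q ij by auto
  with q(1) obtain k where k: "k \<in> I" "k \<in> q \<longleftrightarrow> k \<notin> ?w" "l q k = l ?w k"
    using code by (metis cube_codeD)
  then have "k = i \<or> k = j" by (auto simp: in_tog split: if_splits)
  moreover have "l ?w j = l (tog i q) j"
    using q ij by (subst tog_commute) simp
  ultimately have "l ?w i = P i" using k Pq A by auto
  then show ?thesis using q ij by simp
qed

end

lemma length_singleton: "length xs = 1 \<Longrightarrow> \<exists>a. xs = [a]"
  and length_pair: "length xs = 2 \<Longrightarrow> \<exists>a b. xs = [a, b]"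
  and length_triple: "length xs = 3 \<Longrightarrow> \<exists>a b c. xs = [a, b, c]"
  by (auto simp add: length_Suc_conv eval_nat_numeral)

section \<open>Directed graphs without opposite arcs on five directions\<close>

context
  fixes I :: "'i set" and A :: "'i \<Rightarrow> 'i \<Rightarrow> bool"
  assumes card: "card I = 5" and irrefl: "\<And>i. i \<in> I \<Longrightarrow> \<not> A i i"
    and asym: "\<And>i j. i \<in> I \<Longrightarrow> j \<in> I \<Longrightarrow> A i j \<Longrightarrow> \<not> A j i"
    and out1: "\<And>a b c d e. distinct [a, b, c, d, e] \<Longrightarrow> I = {a, b, c, d, e} \<Longrightarrow>
      A a b \<Longrightarrow> \<not> A a c \<Longrightarrow> \<not> A a d \<Longrightarrow> \<not> A a e \<Longrightarrow> False"
    and out2: "\<And>a b c d e. distinct [a, b, c, d, e] \<Longrightarrow> I = {a, b, c, d, e} \<Longrightarrow>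
      A a b \<Longrightarrow> A a c \<Longrightarrow> \<not> A a d \<Longrightarrow> \<not> A a e \<Longrightarrow> False"
    and out3: "\<And>a b c d e. distinct [a, b, c, d, e] \<Longrightarrow> I = {a, b, c, d, e} \<Longrightarrow>
      A a b \<Longrightarrow> A a c \<Longrightarrow> A a d \<Longrightarrow> \<not> A a e \<Longrightarrow>
      (\<And>i. i \<in> I \<Longrightarrow> \<not> A c i) \<Longrightarrow> (\<And>i. i \<in> I \<Longrightarrow> \<not> A d i) \<Longrightarrow> False"
    and out4: "\<And>a b c d e. distinct [a, b, c, d, e] \<Longrightarrow> I = {a, b, c, d, e} \<Longrightarrow>
      A a b \<Longrightarrow> A a c \<Longrightarrow> A a d \<Longrightarrow> A a e \<Longrightarrow> (\<And>i. i \<in> I \<Longrightarrow> \<not> A b i) \<Longrightarrow>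
      (\<And>i. i \<in> I \<Longrightarrow> \<not> A c i) \<Longrightarrow> (\<And>i. i \<in> I \<Longrightarrow> \<not> A d i) \<Longrightarrow> False"
begin

text \<open>Out-degrees 1 and 2 are excluded by \<open>out1\<close> and \<open>out2\<close>. The
  lists \<open>bs\<close> and \<open>cs\<close> enumerate the other directions, those hit by an arc
  from \<open>a\<close> first, to match the order of the names there.\<close>

lemma out_degree:
  assumes a: "a \<in> I" and b: "b \<in> I" "A a b"
  shows "3 \<le> card {j \<in> I. A a j}"
proof (rule ccontr)
  let ?B = "{j \<in> I. A a j}" and ?C = "{j \<in> I. \<not> A a j} - {a}"
  assume small: "\<not> 3 \<le> card ?B"
  have fin: "finite I" using card card.infinite by fastforce
  obtain bs where bs: "set bs = ?B" "distinct bs" using finite_distinct_list [of ?B] fin by auto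
  obtain cs where cs: "set cs = ?C" "distinct cs" using finite_distinct_list [of ?C] fin by auto
  have dist: "distinct (a # bs @ cs)" and set: "set (a # bs @ cs) = I"
    using bs cs irrefl a by auto
  have pos: "A a j" if "j \<in> set bs" for j using that bs(1) by simp
  have neg: "\<not> A a j" if "j \<in> set cs" for j using that cs(1) by simp
  have len: "length bs + length cs = 4" using set distinct_card [OF dist] card by simp
  have "length bs \<le> 2" using small distinct_card [OF bs(2)] unfolding bs(1) by linarith
  moreover have "0 < length bs" using b bs(1) by auto
  ultimately consider "length bs = 1" "length cs = 3" | "length bs = 2" "length cs = 2"
    using len by linarith
  then show False
  proof cases
    case 1
    obtain u where "bs = [u]" using length_singleton [OF 1(1)] by blast
    moreover obtain v w x where "cs = [v, w, x]" using length_triple [OF 1(2)] by blast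
    ultimately have *: "bs = [u]" "cs = [v, w, x]" by simp_all
    have "distinct [a, u, v, w, x]" "I = {a, u, v, w, x}"
      using dist set [symmetric] unfolding * by auto
    then show ?thesis
      by (rule out1) (use pos neg in \<open>simp_all add: *\<close>)
  next
    case 2
    obtain u v where "bs = [u, v]" using length_pair [OF 2(1)] by blast
    moreover obtain w x where "cs = [w, x]" using length_pair [OF 2(2)] by blast
    ultimately have *: "bs = [u, v]" "cs = [w, x]" by simp_all
    have "distinct [a, u, v, w, x]" "I = {a, u, v, w, x}"
      using dist set [symmetric] unfolding * by auto
    then show ?thesis
      by (rule out2) (use pos neg in \<open>simp_all add: *\<close>)
  qed
qed

text \<open>At most one out-neighbour \<open>u\<close> of \<open>a\<close> has arcs of its own. As
  \<open>a\<close> has at least three out-neighbours, there are then enough without arcs for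
  \<open>out3\<close>, with \<open>u\<close> in the place of its \<open>b\<close>, or for
  \<open>out4\<close>, with \<open>u\<close> in the place of its \<open>e\<close>.\<close>

lemma no_arcs:
  assumes "a \<in> I" "b \<in> I"
  shows "\<not> A a b"
proof
  assume ab: "A a b"
  let ?B = "{j \<in> I. A a j}"
  have fin: "finite I" using card card.infinite by fastforce
  \<comment> \<open>An out-neighbour \<open>j\<close> of \<open>a\<close> with some arc has
    out-degree at least 3, while \<open>a\<close> and \<open>j\<close> itself are forbidden as
    targets. So \<open>j\<close> points to all three remaining directions. Two such out-neighbours
    would therefore be joined by opposite arcs.\<close>
  have full: "A j k" if j: "j \<in> ?B" and k: "k \<in> ?B" "k \<noteq> j" and i: "i \<in> I" "A j i" for i j k
  proof -
    have "{i \<in> I. A j i} \<subseteq> I - {a, j}" using j asym irrefl assms by blast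
    moreover have "card (I - {a, j}) = 3"
      using card j irrefl assms(1) fin by (subst card_Diff_subset) (auto simp: card_insert_if)
    moreover have "3 \<le> card {i \<in> I. A j i}" using out_degree [of j i] j i by simp
    ultimately have "{i \<in> I. A j i} = I - {a, j}" using fin by (metis card_seteq finite_Diff)
    then show ?thesis using k irrefl assms(1) by blast
  qed
  \<comment> \<open>The exceptional out-neighbour is the one that has arcs, if it exists, and
    otherwise \<open>b\<close>.\<close>
  have "\<exists>b\<in>?B. \<forall>j\<in>?B - {b}. \<forall>i\<in>I. \<not> A j i"
  proof (cases "\<exists>j\<in>?B. \<exists>i\<in>I. A j i")
    case True
    then obtain j i where j: "j \<in> ?B" "i \<in> I" "A j i" by blast
    moreover have "\<not> A k i'" if "k \<in> ?B - {j}" "i' \<in> I" for k i'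
    proof
      assume "A k i'"
      then have "A k j" "A j k" using full [of k j i'] full [of j k i] j that by auto
      then show False using asym j that by blast
    qed
    ultimately show ?thesis by blast
  qed (use ab assms in blast)
  then obtain u where u: "u \<in> ?B" and none: "\<And>j i. j \<in> ?B - {u} \<Longrightarrow> i \<in> I \<Longrightarrow> \<not> A j i" by blast
  let ?C = "{j \<in> I. \<not> A a j} - {a}"
  obtain bs where bs: "set bs = ?B - {u}" "distinct bs" using finite_distinct_list [of "?B - {u}"] fin by auto
  obtain cs where cs: "set cs = ?C" "distinct cs" using finite_distinct_list [of ?C] fin by auto
  have dist: "distinct (a # u # bs @ cs)" and set: "set (a # u # bs @ cs) = I"
    using bs cs irrefl assms u by auto
  have pos: "A a j" if "j \<in> set (u # bs)" for j using that bs(1) u by auto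
  have neg: "\<not> A a j" if "j \<in> set cs" for j using that cs(1) by simp
  have zero: "\<not> A j i" if "j \<in> set bs" "i \<in> I" for i j using none [of j i] that unfolding bs(1) by blast
  have len: "length bs + length cs = 3" using set distinct_card [OF dist] card by simp
  have "finite ?B" using fin by simp
  then have "Suc (card (?B - {u})) = card ?B" using u by (rule card_Suc_Diff1)
  moreover have "card (?B - {u}) = length bs" using distinct_card [OF bs(2)] unfolding bs(1) .
  ultimately have "2 \<le> length bs" using out_degree [OF assms ab] by linarith
  then consider "length bs = 2" "length cs = 1" | "length bs = 3" "length cs = 0"
    using len by linarith
  then show False
  proof cases
    case 1
    obtain v w where "bs = [v, w]" using length_pair [OF 1(1)] by blast
    moreover obtain x where "cs = [x]" using length_singleton [OF 1(2)] by blast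
    ultimately have *: "bs = [v, w]" "cs = [x]" by simp_all
    have "distinct [a, u, v, w, x]" "I = {a, u, v, w, x}"
      using dist set [symmetric] unfolding * by auto
    then show ?thesis
      by (rule out3) (use pos neg zero in \<open>simp_all add: *\<close>)
  next
    case 2
    obtain v w x where "bs = [v, w, x]" using length_triple [OF 2(1)] by blast
    moreover have "cs = []" using 2(2) by simp
    ultimately have *: "bs = [v, w, x]" "cs = []" by simp_all
    have "distinct [a, v, w, x, u]" "I = {a, v, w, x, u}"
      using dist set [symmetric] unfolding * by auto
    then show ?thesis
      by (rule out4) (use pos neg zero in \<open>simp_all add: *\<close>)
  qed
qed

end

section \<open>From a pure vertex to its neighbours\<close>

context minimal_labelling
begin

context
  fixes q
  assumes q: "q \<subseteq> I" and pure_q: "pure I P (l q)"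
    and nonconst: "\<And>i. i \<in> I \<Longrightarrow> \<exists>S\<subseteq>I. l S i \<noteq> P i"
begin

text \<open>Rewrites what is known about \<open>q\<close> and its neighbours in model coordinates,
  in the shape of the premises of \<open>two_dirs\<close> to \<open>five_dirs_4\<close>.\<close>

lemma corner_labels:
  assumes e: "inj_on e (set ds)" "e ` set ds = I"
  shows "\<forall>x\<in>set ds. l (corner q e ds (foot x (vx 0))) (e x) = P (e x)"
    and "D1 \<in> set ds \<longrightarrow> (\<forall>x\<in>set ds. l (corner q e ds (foot x (vx 1))) (e x) = l (tog (e D1) q) (e x))"
    and "D2 \<in> set ds \<longrightarrow> (\<forall>x\<in>set ds. l (corner q e ds (foot x (vx 2))) (e x) = l (tog (e D2) q) (e x))"
    and "D3 \<in> set ds \<longrightarrow> (\<forall>x\<in>set ds. l (corner q e ds (foot x (vx 4))) (e x) = l (tog (e D3) q) (e x))"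
    and "D4 \<in> set ds \<longrightarrow> (\<forall>x\<in>set ds. l (corner q e ds (foot x (vx 8))) (e x) = l (tog (e D4) q) (e x))"
proof -
  have q': "q \<subseteq> e ` set ds" using q e(2) by simp
  have c [simp]: "corner q e ds v \<subseteq> I" for v using corner_subset [OF q'] e(2) by simp
  have eI: "e x \<in> I" if "x \<in> set ds" for x using e(2) that by blast
  have foot: "l (corner q e ds (foot x v)) (e x) = l (corner q e ds v) (e x)" if "x \<in> set ds" for x v
    using eI [OF that] by (simp add: foot_eq corner_nbr [OF e(1) q' that])
  have nbr: "corner q e ds (nbr x (vx 0)) = tog (e x) q" if "x \<in> set ds" for x
    by (simp add: corner_nbr [OF e(1) q' that] corner_0)
  show "\<forall>x\<in>set ds. l (corner q e ds (foot x (vx 0))) (e x) = P (e x)"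
    using pure_q eI by (simp add: pure_def foot corner_0)
  show "D1 \<in> set ds \<longrightarrow> (\<forall>x\<in>set ds. l (corner q e ds (foot x (vx 1))) (e x) = l (tog (e D1) q) (e x))"
    and "D2 \<in> set ds \<longrightarrow> (\<forall>x\<in>set ds. l (corner q e ds (foot x (vx 2))) (e x) = l (tog (e D2) q) (e x))"
    and "D3 \<in> set ds \<longrightarrow> (\<forall>x\<in>set ds. l (corner q e ds (foot x (vx 4))) (e x) = l (tog (e D3) q) (e x))"
    and "D4 \<in> set ds \<longrightarrow> (\<forall>x\<in>set ds. l (corner q e ds (foot x (vx 8))) (e x) = l (tog (e D4) q) (e x))"
    by (auto simp only: foot nbr vx_simps(2-))
qed

text \<open>With at most four directions a single arc from \<open>i\<close> to \<open>j\<close> is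
  refuted directly, whatever the order of the remaining directions. With five directions the cores
  only exclude certain out-neighbourhoods, and \<open>no_arcs\<close> combines them.\<close>

lemma pure_neighbour:
  assumes "card I \<le> 5" and ij: "i \<in> I" "j \<in> I"
  shows "l (tog i q) j = P j"
proof (cases "i = j")
  case True
  then show ?thesis using q ij pure_q by (simp add: pure_def)
next
  case False
  obtain xs where xs: "set xs = I - {i, j}" "distinct xs"
    using fin finite_distinct_list by (metis finite_Diff)
  have I: "I = set (i # j # xs)" "distinct (i # j # xs)" using xs ij False by auto
  then have "card I = Suc (Suc (length xs))" using distinct_card by force
  then consider "length xs = 0" | "length xs = 1" | "length xs = 2" | "length xs = 3" "card I = 5"
    using assms(1) by linarith
  then show ?thesis
  proof cases
    case 1
    \<comment> \<open>\<open>i\<close> takes the place of \<open>D1\<close> and \<open>j\<close>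
      that of \<open>D2\<close>; the values of \<open>?e\<close> at directions outside
      \<open>?ds\<close> are dummies. The next two cases proceed in the same way.\<close>
    let ?e = "case_dir i j i i i" and ?ds = "[D1, D2]"
    have e: "inj_on ?e (set ?ds)" "?e ` set ?ds = I" using 1 I by auto
    show ?thesis
    proof (rule ccontr)
      assume "l (tog i q) j \<noteq> P j"
      then show False
        by (intro two_dirs [OF stuck_corner [OF q e nonconst]]) (use corner_labels [OF e] in simp_all)
    qed
  next
    case 2
    then obtain k where k: "xs = [k]" using length_singleton by blast
    let ?e = "case_dir i j k i i" and ?ds = "[D1, D2, D3]"
    have e: "inj_on ?e (set ?ds)" "?e ` set ?ds = I" using k I by auto
    show ?thesis
    proof (rule ccontr)
      assume "l (tog i q) j \<noteq> P j"
      then show False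
        by (intro three_dirs [OF stuck_corner [OF q e nonconst]]) (use corner_labels [OF e] in simp_all)
    qed
  next
    case 3
    then obtain k m where k: "xs = [k, m]" using length_pair by blast
    let ?e = "case_dir i j k m i" and ?ds = "[D1, D2, D3, D4]"
    have e: "inj_on ?e (set ?ds)" "?e ` set ?ds = I" using k I by auto
    show ?thesis
    proof (rule ccontr)
      assume "l (tog i q) j \<noteq> P j"
      then show False
        by (intro four_dirs [OF stuck_corner [OF q e nonconst]]) (use corner_labels [OF e] in simp_all)
    qed
  next
    case 4
    let ?A = "\<lambda>i j. l (tog i q) j \<noteq> P j" and ?ds = "[D1, D2, D3, D4, D5]"
    have e: "inj_on (case_dir a b c d e) (set ?ds)" "case_dir a b c d e ` set ?ds = I"
      if "distinct [a, b, c, d, e]" "I = {a, b, c, d, e}" for a b c d e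
      using that by auto
    have irr: "\<not> ?A i i" if "i \<in> I" for i using that q pure_q by (simp add: pure_def)
    have asym: "\<not> ?A j i" if "i \<in> I" "j \<in> I" "?A i j" for i j
      using oriented [OF q pure_q that] by simp
    have "\<not> ?A i j"
    proof (rule no_arcs [of I ?A])
      fix a b c d e
      assume I': "distinct [a, b, c, d, e]" "I = {a, b, c, d, e}"
      note labels = corner_labels [OF e [OF I']] and st = stuck_corner [OF q e [OF I'] nonconst]
      have irrefl: "\<not> ?A a a" "\<not> ?A b b" "\<not> ?A c c" "\<not> ?A d d" using irr I'(2) by auto
      show False if "?A a b" "\<not> ?A a c" "\<not> ?A a d" "\<not> ?A a e"
        by (rule five_dirs_1 [OF st]) (use that labels irrefl in simp_all)
      show False if "?A a b" "?A a c" "\<not> ?A a d" "\<not> ?A a e"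
        by (rule five_dirs_2 [OF st]) (use that labels irrefl in simp_all)
      show False if "?A a b" "?A a c" "?A a d" "\<not> ?A a e"
        "\<And>i. i \<in> I \<Longrightarrow> \<not> ?A c i" "\<And>i. i \<in> I \<Longrightarrow> \<not> ?A d i"
        by (rule five_dirs_3 [OF st]) (use that(1-4) that(5,6) I'(2) [THEN equalityD2] labels irrefl in simp_all)
      show False if "?A a b" "?A a c" "?A a d" "?A a e" "\<And>i. i \<in> I \<Longrightarrow> \<not> ?A b i"
        "\<And>i. i \<in> I \<Longrightarrow> \<not> ?A c i" "\<And>i. i \<in> I \<Longrightarrow> \<not> ?A d i"
        by (rule five_dirs_4 [OF st]) (use that(1-4) that(5-7) I'(2) [THEN equalityD2] labels irrefl in simp_all)
    qed (use 4 irr asym ij in auto)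
    then show ?thesis by simp
  qed
qed

end

end

section \<open>Connectedness\<close>

definition conn :: "'i set \<Rightarrow> ('i \<Rightarrow> 'a set) \<Rightarrow> 'i set set \<Rightarrow> ('i \<Rightarrow> 'a) \<Rightarrow> ('i set \<Rightarrow> 'i \<Rightarrow> 'a) \<Rightarrow> bool" where
  "conn I N K P l \<longleftrightarrow> (\<exists>l'. (move I N K)\<^sup>*\<^sup>* l l' \<and> (\<forall>S\<subseteq>I. pure I P (l' S)))"

text \<open>\<open>B\<close> is \<open>{}\<close> or \<open>{i}\<close> and selects one of the two
  facets orthogonal to direction \<open>i\<close>, whose vertices are the sets
  \<open>S \<union> B\<close>. Moves of the facet are moves of the whole cube because its labels in
  direction \<open>i\<close> are all \<open>c\<close>, so that a twin pair of the facet is one of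
  the cube. The last clause keeps the other facet and direction \<open>i\<close> untouched.\<close>

lemma moves_facet:
  assumes i: "i \<in> I" and B: "B \<subseteq> {i}"
    and moves: "(move (I - {i}) N {S. S \<subseteq> I - {i} \<and> S \<union> B \<in> K})\<^sup>*\<^sup>* m m'"
    and m: "\<And>S j. S \<subseteq> I - {i} \<Longrightarrow> j \<in> I \<Longrightarrow> j \<noteq> i \<Longrightarrow> m S j = l (S \<union> B) j"
    and c: "\<And>S. S \<subseteq> I - {i} \<Longrightarrow> l (S \<union> B) i = c"
  shows "\<exists>l'. (move I N K)\<^sup>*\<^sup>* l l' \<and> (\<forall>S j. S \<subseteq> I - {i} \<longrightarrow> j \<in> I \<longrightarrow> j \<noteq> i \<longrightarrow> l' (S \<union> B) j = m' S j) \<and>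
    (\<forall>S j. j = i \<or> S \<inter> {i} \<noteq> B \<longrightarrow> l' S j = l S j)"
  using moves
proof (induction rule: rtranclp_induct)
  case base
  then show ?case using m by (intro exI [of _ l]) auto
next
  case (step m1 m2)
  obtain l1 where l1: "(move I N K)\<^sup>*\<^sup>* l l1"
    and eq: "\<And>S j. S \<subseteq> I - {i} \<Longrightarrow> j \<in> I \<Longrightarrow> j \<noteq> i \<Longrightarrow> l1 (S \<union> B) j = m1 S j"
    and fix1: "\<And>S j. j = i \<or> S \<inter> {i} \<noteq> B \<Longrightarrow> l1 S j = l S j"
    using step.IH by blast
  obtain S k z where tw: "twin (I - {i}) m1 S k" and z: "z \<in> N k"
    and K: "S \<notin> {S. S \<subseteq> I - {i} \<and> S \<union> B \<in> K}" "tog k S \<notin> {S. S \<subseteq> I - {i} \<and> S \<union> B \<in> K}"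
    and m2: "m2 = relabel m1 S k z"
    using step.hyps(2) unfolding move_def by blast
  have S: "S \<subseteq> I - {i}" and k: "k \<in> I" "k \<noteq> i" using tw by (auto simp: twin_def)
  have tS: "tog k S \<subseteq> I - {i}" using S k by simp
  have tB: "tog k (S \<union> B) = tog k S \<union> B" using B k by (auto simp: tog_def)
  let ?l2 = "relabel l1 (S \<union> B) k z"
  have "l1 (S \<union> B) j = l1 (tog k (S \<union> B)) j" if "j \<in> I" "j \<noteq> k" for j
  proof (cases "j = i")
    case True
    then show ?thesis using fix1 c [OF S] c [OF tS] by (simp add: tB)
  next
    case False
    then show ?thesis using eq [OF S] eq [OF tS] tw that by (simp add: tB twin_def)
  qed
  moreover have "S \<union> B \<subseteq> I" using S B i by auto
  ultimately have "twin I l1 (S \<union> B) k" using k by (auto simp: twin_def)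
  moreover have "S \<union> B \<notin> K" "tog k (S \<union> B) \<notin> K" using K S tS by (auto simp: tB)
  ultimately have "move I N K l1 ?l2" unfolding move_def using z by blast
  then have reach: "(move I N K)\<^sup>*\<^sup>* l ?l2" using l1 by (meson r_into_rtranclp rtranclp_trans)
  have eq2: "?l2 (T \<union> B) j = m2 T j" if T: "T \<subseteq> I - {i}" "j \<in> I" "j \<noteq> i" for T j
  proof -
    have "T \<union> B = U \<union> B \<longleftrightarrow> T = U" if "U \<subseteq> I - {i}" for U using T(1) that B by blast
    then show ?thesis using eq [OF T] S tS by (auto simp: relabel_def m2 tB)
  qed
  have fix2: "?l2 T j = l T j" if "j = i \<or> T \<inter> {i} \<noteq> B" for T j
  proof -
    have "(S \<union> B) \<inter> {i} = B" "tog k (S \<union> B) \<inter> {i} = B" using S tS B by (auto simp: tB)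
    then have "\<not> (j = k \<and> (T = S \<union> B \<or> T = tog k (S \<union> B)))" using that k by auto
    then show ?thesis using fix1 [OF that] by (auto simp: relabel_def)
  qed
  show ?case
    by (intro exI [of _ ?l2] conjI allI impI) (fact reach, erule (2) eq2, erule fix2)
qed

text \<open>Two vertices of a facet do not differ in direction \<open>i\<close>, so their common
  label is in a direction of the facet.\<close>

lemma labelling_facet:
  assumes "labelling I N l" "i \<in> I" "B \<subseteq> {i}"
    and c: "\<And>S. S \<subseteq> I - {i} \<Longrightarrow> l (S \<union> B) i = c"
  shows "labelling (I - {i}) N (\<lambda>S. l (S \<union> B))"
  unfolding labelling_def cube_code_def
proof (intro conjI allI impI ballI)
  fix S T assume ST: "S \<subseteq> I - {i}" "T \<subseteq> I - {i}" "S \<noteq> T"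
  have "S \<union> B \<subseteq> I" "T \<union> B \<subseteq> I" "S \<union> B \<noteq> T \<union> B" using ST assms(2,3) by blast+
  then obtain j where j: "j \<in> I" "j \<in> S \<union> B \<longleftrightarrow> j \<notin> T \<union> B" "l (S \<union> B) j = l (T \<union> B) j"
    using assms(1) unfolding labelling_def by (metis cube_codeD)
  then show "\<exists>j\<in>sym_diff S T. l (S \<union> B) j = l (T \<union> B) j" by blast
next
  fix S j assume Sj: "S \<subseteq> I - {i}" "j \<in> I - {i}"
  then have "S \<union> B \<subseteq> I" using assms(2,3) by blast
  then show "l (S \<union> B) j \<in> N j"
    using assms(1) Sj(2) by (simp add: labelling_def)
qed

text \<open>The induction hypothesis makes the two facets orthogonal to \<open>i\<close> pure in
  turn, outside direction \<open>i\<close>. If \<open>c\<close> is not yet \<open>P i\<close>,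
  nothing is frozen, and every edge in direction \<open>i\<close> is now a twin pair that can be
  relabelled.\<close>

lemma conn_const:
  assumes fin: "finite I" and lab: "labelling I N l" and P: "\<And>i. i \<in> I \<Longrightarrow> P i \<in> N i"
    and K: "\<And>S. S \<in> K \<Longrightarrow> pure I P (l S)"
    and i: "i \<in> I" and const: "\<And>S. S \<subseteq> I \<Longrightarrow> l S i = c" and cK: "c = P i \<or> K = {}"
    and IH: "\<And>K l. labelling (I - {i}) N l \<Longrightarrow> (\<And>S. S \<in> K \<Longrightarrow> pure (I - {i}) P (l S)) \<Longrightarrow>
      conn (I - {i}) N K P l"
  shows "conn I N K P l"
proof -
  \<comment> \<open>Stated for any labelling that is constant in direction \<open>i\<close>, as it
    is applied first to \<open>l\<close> with \<open>B = {}\<close> and then to its outcome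
    \<open>l1\<close> with \<open>B = {i}\<close>.\<close>
  have facet: "\<exists>l'. (move I N K)\<^sup>*\<^sup>* l l' \<and>
      (\<forall>S j. S \<subseteq> I - {i} \<longrightarrow> j \<in> I \<longrightarrow> j \<noteq> i \<longrightarrow> l' (S \<union> B) j = P j) \<and>
      (\<forall>S j. j = i \<or> S \<inter> {i} \<noteq> B \<longrightarrow> l' S j = l S j)"
    if B: "B \<subseteq> {i}" and lab: "labelling I N l" and K: "\<And>S. S \<in> K \<Longrightarrow> pure I P (l S)"
      and const: "\<And>S. S \<subseteq> I \<Longrightarrow> l S i = c" for B l
  proof -
    let ?K = "{S. S \<subseteq> I - {i} \<and> S \<union> B \<in> K}"
    have c: "l (S \<union> B) i = c" if "S \<subseteq> I - {i}" for S
      using that B i by (intro const) auto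
    have "conn (I - {i}) N ?K P (\<lambda>S. l (S \<union> B))"
      using labelling_facet [OF lab i B c] K by (intro IH) (auto simp: pure_def)
    then obtain m' where m': "(move (I - {i}) N ?K)\<^sup>*\<^sup>* (\<lambda>S. l (S \<union> B)) m'"
      "\<And>S. S \<subseteq> I - {i} \<Longrightarrow> pure (I - {i}) P (m' S)" unfolding conn_def by blast
    obtain l' where l': "(move I N K)\<^sup>*\<^sup>* l l'"
      "\<And>S j. S \<subseteq> I - {i} \<Longrightarrow> j \<in> I \<Longrightarrow> j \<noteq> i \<Longrightarrow> l' (S \<union> B) j = m' S j"
      "\<And>S j. j = i \<or> S \<inter> {i} \<noteq> B \<Longrightarrow> l' S j = l S j"
      using moves_facet [OF i B m'(1), of l c] c by blast
    moreover have "m' S j = P j" if "S \<subseteq> I - {i}" "j \<in> I" "j \<noteq> i" for S j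
      using m'(2) [OF that(1)] that by (simp add: pure_def)
    ultimately show ?thesis by (intro exI [of _ l']) simp
  qed
  have "\<exists>l'. (move I N K)\<^sup>*\<^sup>* l l' \<and>
      (\<forall>S j. S \<subseteq> I - {i} \<longrightarrow> j \<in> I \<longrightarrow> j \<noteq> i \<longrightarrow> l' (S \<union> {}) j = P j) \<and>
      (\<forall>S j. j = i \<or> S \<inter> {i} \<noteq> {} \<longrightarrow> l' S j = l S j)"
    by (rule facet) (simp_all add: lab K const)
  then obtain l1 where l1: "(move I N K)\<^sup>*\<^sup>* l l1"
    and P1': "\<forall>S j. S \<subseteq> I - {i} \<longrightarrow> j \<in> I \<longrightarrow> j \<noteq> i \<longrightarrow> l1 (S \<union> {}) j = P j"
    and f1': "\<forall>S j. j = i \<or> S \<inter> {i} \<noteq> {} \<longrightarrow> l1 S j = l S j"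
    by (elim exE conjE)
  have P1: "l1 S j = P j" if "S \<subseteq> I - {i}" "j \<in> I" "j \<noteq> i" for S j
    using P1' that by simp
  have f1: "l1 S j = l S j" if "j = i \<or> i \<in> S" for S j
    using f1' [rule_format, of j S] that by auto
  have lab1: "labelling I N l1" using moves_labelling [OF l1 lab] .
  have K1: "pure I P (l1 S)" if "S \<in> K" for S using K [OF that] moves_keep [OF l1 that] by simp
  have const1: "l1 S i = c" if "S \<subseteq> I" for S using const [OF that] f1 by simp
  have "\<exists>l'. (move I N K)\<^sup>*\<^sup>* l1 l' \<and>
      (\<forall>S j. S \<subseteq> I - {i} \<longrightarrow> j \<in> I \<longrightarrow> j \<noteq> i \<longrightarrow> l' (S \<union> {i}) j = P j) \<and>
      (\<forall>S j. j = i \<or> S \<inter> {i} \<noteq> {i} \<longrightarrow> l' S j = l1 S j)"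
    by (rule facet) (simp_all add: lab1 K1 const1)
  then obtain l2 where l2: "(move I N K)\<^sup>*\<^sup>* l1 l2"
    and P2': "\<forall>S j. S \<subseteq> I - {i} \<longrightarrow> j \<in> I \<longrightarrow> j \<noteq> i \<longrightarrow> l2 (S \<union> {i}) j = P j"
    and f2': "\<forall>S j. j = i \<or> S \<inter> {i} \<noteq> {i} \<longrightarrow> l2 S j = l1 S j"
    by (elim exE conjE)
  have P2: "l2 (insert i S) j = P j" if "S \<subseteq> I - {i}" "j \<in> I" "j \<noteq> i" for S j
    using P2' that by simp
  have f2: "l2 S j = l1 S j" if "j = i \<or> i \<notin> S" for S j
    using f2' [rule_format, of j S] that by auto
  have const2: "l2 S i = c" if "S \<subseteq> I" for S using const1 [OF that] f2 by simp
  have pure2: "l2 S j = P j" if "S \<subseteq> I" "j \<in> I" "j \<noteq> i" for S j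
  proof (cases "i \<in> S")
    case True
    then have "S = insert i (S - {i})" by blast
    then show ?thesis using P2 [of "S - {i}" j] that by auto
  next
    case False
    then show ?thesis using f2 P1 [of S j] that by auto
  qed
  have reach: "(move I N K)\<^sup>*\<^sup>* l l2" using l1 l2 by simp
  show ?thesis
  proof (cases "c = P i")
    case True
    then have "pure I P (l2 S)" if "S \<subseteq> I" for S
      using const2 [OF that] pure2 [OF that] by (auto simp: pure_def)
    then show ?thesis using reach unfolding conn_def by blast
  next
    case False
    then have K0: "K = {}" using cK by blast
    \<comment> \<open>\<open>E\<close> consists of the lower ends of the edges in direction
      \<open>i\<close> that have already been relabelled.\<close>
    have "\<exists>l'. (move I N K)\<^sup>*\<^sup>* l l' \<and> (\<forall>S j. S \<subseteq> I \<longrightarrow> j \<in> I \<longrightarrow> j \<noteq> i \<longrightarrow> l' S j = P j) \<and>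
        (\<forall>S\<in>E. l' S i = P i \<and> l' (insert i S) i = P i)"
      if "finite E" "E \<subseteq> Pow (I - {i})" for E
      using that
    proof (induction E rule: finite_induct)
      case empty
      then show ?case using reach pure2 by blast
    next
      case (insert S E)
      then obtain l' where l': "(move I N K)\<^sup>*\<^sup>* l l'"
        "\<And>S j. S \<subseteq> I \<Longrightarrow> j \<in> I \<Longrightarrow> j \<noteq> i \<Longrightarrow> l' S j = P j"
        "\<And>S. S \<in> E \<Longrightarrow> l' S i = P i \<and> l' (insert i S) i = P i" by auto
      have S: "S \<subseteq> I" "i \<notin> S" using insert.prems by auto
      have "twin I l' S i" using S i l'(2) by (simp add: twin_def)
      then have "move I N K l' (relabel l' S i (P i))"
        unfolding move_def using P [OF i] K0 by blast
      then have "(move I N K)\<^sup>*\<^sup>* l (relabel l' S i (P i))" using l'(1) by simp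
      moreover have "tog i S = insert i S" using S by (auto simp: tog_def)
      ultimately show ?case using l'(2,3) S
        by (intro exI [of _ "relabel l' S i (P i)"]) (auto simp: relabel_def)
    qed
    from this [of "Pow (I - {i})"] fin obtain l' where l': "(move I N K)\<^sup>*\<^sup>* l l'"
      "\<And>S j. S \<subseteq> I \<Longrightarrow> j \<in> I \<Longrightarrow> j \<noteq> i \<Longrightarrow> l' S j = P j"
      "\<And>S. S \<subseteq> I - {i} \<Longrightarrow> l' S i = P i \<and> l' (insert i S) i = P i" by auto
    have "l' S i = P i" if "S \<subseteq> I" for S
      using l'(3) [of "S - {i}"] that by (cases "i \<in> S") (auto simp: insert_absorb)
    then have "pure I P (l' S)" if "S \<subseteq> I" for S
      using l'(2) that by (auto simp: pure_def)
    then show ?thesis using l'(1) unfolding conn_def by blast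
  qed
qed

text \<open>Every \<open>S\<close> is reached from \<open>q\<close> by toggling the elements of
  their symmetric difference one by one.\<close>

lemma cube_connected:
  assumes "finite I" and q: "q \<subseteq> I" "Q q" and step: "\<And>S i. S \<subseteq> I \<Longrightarrow> Q S \<Longrightarrow> i \<in> I \<Longrightarrow> Q (tog i S)"
    and S: "S \<subseteq> I"
  shows "Q S"
proof -
  have "Q (sym_diff q D)" if "finite D" "D \<subseteq> I" for D
    using that
  proof (induction D rule: finite_induct)
    case (insert i D)
    then have "sym_diff q (insert i D) = tog i (sym_diff q D)" by (auto simp: tog_def)
    then show ?case using insert q(1) by (auto intro!: step)
  qed (use q in simp)
  moreover have "finite (sym_diff q S)" "sym_diff q S \<subseteq> I"
    using assms(1) q(1) S by (auto intro: finite_subset)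
  moreover have "sym_diff q (sym_diff q S) = S" by blast
  ultimately show ?thesis by metis
qed

text \<open>Induction on the number of directions. If a vertex \<open>q\<close> is frozen, pass to a
  minimal reachable labelling: either some direction is correct throughout and
  \<open>conn_const\<close> applies, or every direction has a wrong label and
  \<open>pure_neighbour\<close> spreads purity from \<open>q\<close> over the whole cube.\<close>

lemma labellings_connected:
  fixes I :: "'i set"
  assumes "finite I" "card I \<le> 5" "labelling I N l" "\<And>i. i \<in> I \<Longrightarrow> P i \<in> N i"
    and "\<And>S. S \<in> K \<Longrightarrow> pure I P (l S)"
  shows "conn I N K P l"
  using assms
proof (induction "card I" arbitrary: I K P l)
  case 0
  then show ?case by (auto simp: conn_def pure_def)
next
  case (Suc n)
  have IH: "conn (I - {i}) N K P l"
    if "i \<in> I" "labelling (I - {i}) N l" "\<And>j. j \<in> I \<Longrightarrow> P j \<in> N j"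
      "\<And>S. S \<in> K \<Longrightarrow> pure (I - {i}) P (l S)" for i K P and l :: "'i set \<Rightarrow> 'i \<Rightarrow> 'a"
    using Suc.hyps(1) [of "I - {i}" l P K] Suc.hyps(2) Suc.prems(1,2) that by simp
  have pure_vertex: "conn I N K P l"
    if lab: "labelling I N l" and P: "\<And>i. i \<in> I \<Longrightarrow> P i \<in> N i"
      and K: "\<And>S. S \<in> K \<Longrightarrow> pure I P (l S)" and q: "q \<subseteq> I" "q \<in> K" for l K P q
  proof -
    obtain l1 where l1: "(move I N K)\<^sup>*\<^sup>* l l1" and min: "minimal I N K P l1"
      by (rule minimal_reachable)
    have lab1: "labelling I N l1" using moves_labelling [OF l1 lab] .
    have K1: "pure I P (l1 S)" if "S \<in> K" for S using K [OF that] moves_keep [OF l1 that] by simp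
    interpret minimal_labelling I N K P l1
      using Suc.prems(1) lab1 P K1 min by unfold_locales
    have "conn I N K P l1"
    proof (cases "\<exists>i\<in>I. \<forall>S\<subseteq>I. l1 S i = P i")
      case True
      then obtain i where i: "i \<in> I" "\<And>S. S \<subseteq> I \<Longrightarrow> l1 S i = P i" by blast
      show ?thesis
        by (rule conn_const [OF Suc.prems(1) lab1 P K1 i]) (use IH i P in auto)
    next
      case False
      then have nonconst: "\<exists>S\<subseteq>I. l1 S i \<noteq> P i" if "i \<in> I" for i using that by blast
      have "pure I P (l1 S)" if "S \<subseteq> I" for S
        using Suc.prems(1) q(1) K1 [OF q(2)] _ that
      proof (rule cube_connected)
        fix S i assume "S \<subseteq> I" "pure I P (l1 S)" "i \<in> I"
        then show "pure I P (l1 (tog i S))"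
          using pure_neighbour [OF _ _ nonconst Suc.prems(2)] unfolding pure_def by blast
      qed
      then show ?thesis unfolding conn_def by blast
    qed
    then show ?thesis using l1 unfolding conn_def by (meson rtranclp_trans)
  qed
  obtain i where i: "i \<in> I" using Suc.hyps(2) by fastforce
  show ?case
  proof (cases "\<exists>q\<in>K. q \<subseteq> I")
    case True
    then show ?thesis using pure_vertex Suc.prems by blast
  next
    case False
    \<comment> \<open>Without a frozen vertex in the cube, freeze \<open>{}\<close> and take its own
      labels as the target. The labelling becomes constant, and \<open>conn_const\<close> with
      nothing frozen leads on to \<open>P\<close>.\<close>
    have "conn I N {{}} (l {}) l"
      using Suc.prems(3) by (intro pure_vertex [where q = "{}"]) (auto simp: pure_def labelling_def)
    then obtain l1 where l1: "(move I N {{}})\<^sup>*\<^sup>* l l1" "\<And>S. S \<subseteq> I \<Longrightarrow> pure I (l {}) (l1 S)"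
      unfolding conn_def by blast
    have mono: "move I N {{}} l l' \<Longrightarrow> move I N {} l l'" for l l' :: "'i set \<Rightarrow> 'i \<Rightarrow> 'a"
      unfolding move_def by blast
    have l1': "(move I N {})\<^sup>*\<^sup>* l l1"
      using l1(1) by (rule rtranclp_mono [THEN predicate2D, rotated]) (use mono in blast)
    have "conn I N {} P l1"
      by (rule conn_const [OF Suc.prems(1) moves_labelling [OF l1' Suc.prems(3)] Suc.prems(4) _ i, where c = "l {} i"])
        (use l1(2) i IH Suc.prems(4) in \<open>auto simp: pure_def\<close>)
    then obtain l2 where "(move I N {})\<^sup>*\<^sup>* l l2" "\<And>S. S \<subseteq> I \<Longrightarrow> pure I P (l2 S)"
      using l1' unfolding conn_def by (meson rtranclp_trans)
    \<comment> \<open>\<open>K\<close> contains no vertex of the cube, so it blocks no move.\<close>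
    moreover have "move I N {} l l' \<Longrightarrow> move I N K l l'" for l l' :: "'i set \<Rightarrow> 'i \<Rightarrow> 'a"
      unfolding move_def twin_def using False by (metis empty_iff tog_subset)
    then have "(move I N {})\<^sup>*\<^sup>* \<le> (move I N K)\<^sup>*\<^sup>*" by (intro rtranclp_mono) blast
    ultimately show ?thesis unfolding conn_def by blast
  qed
qed

section \<open>Words and labellings\<close>

definition dich :: "'n word \<Rightarrow> 'n word \<Rightarrow> bool" where
  "dich u v \<longleftrightarrow> (\<exists>j. u j = Zero \<and> v j = One \<or> u j = One \<and> v j = Zero)"

lemma not_dich_refl: "\<not> dich u u"
  by (auto simp: dich_def)

lemma domino_cbox:
  fixes u :: "'n::finite word"
  shows "domino u = cbox (\<chi> j. if u j = One then 1 else 0) (\<chi> j. if u j = Zero then 1 else 2)"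
proof (rule set_eqI)
  fix x :: "real ^ 'n"
  have "x $ j \<in> side (u j) \<longleftrightarrow> (if u j = One then 1 else 0) \<le> x $ j \<and> x $ j \<le> (if u j = Zero then 1 else 2)" for j
    by (cases "u j") auto
  then show "x \<in> domino u \<longleftrightarrow>
      x \<in> cbox (\<chi> j. if u j = One then 1 else 0) (\<chi> j. if u j = Zero then 1 else 2)"
    by (simp add: domino_def mem_box_cart)
qed

lemma interior_domino:
  "x \<in> interior (domino u) \<longleftrightarrow>
    (\<forall>j. (if u j = One then 1 else 0) < x $ j \<and> x $ j < (if u j = Zero then 1 else 2))"
  by (simp add: domino_cbox interior_cbox mem_box_cart)

lemma interiors_disjoint_iff: "interior (domino u) \<inter> interior (domino v) = {} \<longleftrightarrow> dich u v"
proof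
  assume disj: "interior (domino u) \<inter> interior (domino v) = {}"
  show "dich u v"
  proof (rule ccontr)
    assume nd: "\<not> dich u v"
    \<comment> \<open>The centre of a unit cube inside both dominoes: no side separates
      \<open>u\<close> from \<open>v\<close>, so the lower half can be chosen wherever one of them
      requires it and the upper half elsewhere.\<close>
    let ?x = "(\<chi> j. if u j = Zero \<or> v j = Zero then 1 / 2 else 3 / 2) :: real ^ 'a"
    have "u j = One \<Longrightarrow> v j \<noteq> Zero" "v j = One \<Longrightarrow> u j \<noteq> Zero" for j
      using nd by (auto simp: dich_def)
    then have "?x \<in> interior (domino u)" "?x \<in> interior (domino v)"
      unfolding interior_domino by auto
    with disj show False by blast
  qed
next
  assume "dich u v"
  then obtain j where j: "u j = Zero \<and> v j = One \<or> u j = One \<and> v j = Zero"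
    unfolding dich_def by blast
  show "interior (domino u) \<inter> interior (domino v) = {}"
  proof (rule ccontr)
    assume "interior (domino u) \<inter> interior (domino v) \<noteq> {}"
    then obtain x where "x \<in> interior (domino u)" "x \<in> interior (domino v)" by blast
    then have "(if u j = One then 1 else 0) < x $ j \<and> x $ j < (if u j = Zero then 1 else 2)"
      "(if v j = One then 1 else 0) < x $ j \<and> x $ j < (if v j = Zero then 1 else 2)"
      unfolding interior_domino by blast+
    with j show False by auto
  qed
qed

lemma tiling_dich: "tiling d D \<Longrightarrow> u \<in> D \<Longrightarrow> v \<in> D \<Longrightarrow> u \<noteq> v \<Longrightarrow> dich u v"
  unfolding tiling_def interiors_disjoint_iff by blast

text \<open>The centre of the unit cube whose upper-half coordinates are given by \<open>f\<close>
  lies in some domino, and its word must be compatible with \<open>f\<close>.\<close>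

lemma tiling_covers:
  assumes "tiling d D"
  obtains u where "u \<in> D" "\<And>j. u j = Zero \<Longrightarrow> \<not> f j" "\<And>j. u j = One \<Longrightarrow> f j"
proof -
  let ?x = "(\<chi> j. if f j then 3 / 2 else 1 / 2) :: real ^ 'a"
  have "\<Union> (domino ` D) = {x. \<forall>j. x $ j \<in> {0..2}}"
    using assms unfolding tiling_def by (elim conjE)
  moreover have "?x \<in> {x. \<forall>j. x $ j \<in> {0..2}}" by simp
  ultimately have "?x \<in> \<Union> (domino ` D)" by (simp only:)
  then obtain u where u: "u \<in> D" "?x \<in> domino u" by (rule UN_E)
  then have x: "?x $ j \<in> side (u j)" for j by (simp add: domino_def)
  show thesis
  proof (rule that [OF u(1)])
    fix j
    show "u j = Zero \<Longrightarrow> \<not> f j" "u j = One \<Longrightarrow> f j"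
      using x [of j] by (auto split: if_splits)
  qed
qed

section \<open>The words of a labelling, and moves as flips\<close>

definition wrd :: "'i set \<Rightarrow> ('i \<Rightarrow> 'n) \<Rightarrow> 'i set \<Rightarrow> 'n word" where
  "wrd I w S = (\<lambda>j. if \<exists>i\<in>I. w i = j then (if \<exists>i\<in>I \<inter> S. w i = j then One else Zero) else Star)"

definition words :: "'i set \<Rightarrow> ('i set \<Rightarrow> 'i \<Rightarrow> 'n) \<Rightarrow> 'n word set" where
  "words I l = (\<lambda>S. wrd I (l S) S) ` Pow I"

lemma propset_wrd: "propset (wrd I w S) = w ` I"
  by (auto simp: propset_def wrd_def)

lemma wrd_at: "inj_on w I \<Longrightarrow> i \<in> I \<Longrightarrow> wrd I w S (w i) = (if i \<in> S then One else Zero)"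
  by (auto simp: wrd_def dest: inj_onD)

lemma wrd_eq_Star: "wrd I w S j = Star \<longleftrightarrow> j \<notin> w ` I"
  by (auto simp: wrd_def)

lemma wrd_cong: "(\<And>i. i \<in> I \<Longrightarrow> w i = w' i) \<Longrightarrow> I \<inter> S = I \<inter> T \<Longrightarrow> wrd I w S = wrd I w' T"
  by (auto simp: wrd_def fun_eq_iff)

text \<open>Separates the one position that a flip in direction \<open>i\<close> changes from the
  part of the word that both members of a twin pair share.\<close>

lemma wrd_remove:
  assumes "inj_on w I" "i \<in> I"
  shows "wrd I w S = (wrd (I - {i}) w S)(w i := if i \<in> S then One else Zero)"
proof
  fix j
  show "wrd I w S j = ((wrd (I - {i}) w S)(w i := if i \<in> S then One else Zero)) j"
  proof (cases "j = w i")
    case True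
    then show ?thesis using wrd_at [OF assms] by simp
  next
    case False
    then show ?thesis using assms(2) by (auto simp: wrd_def)
  qed
qed

lemma wrd_eqI:
  assumes inj: "inj_on w I" and "propset u = w ` I" and "\<And>i. i \<in> I \<Longrightarrow> u (w i) = One \<longleftrightarrow> i \<in> S"
  shows "u = wrd I w S"
proof
  fix j
  show "u j = wrd I w S j"
  proof (cases "j \<in> w ` I")
    case True
    then obtain i where i: "i \<in> I" "j = w i" by blast
    then have "u j \<noteq> Star" using assms(2) by (auto simp: propset_def)
    then show ?thesis using wrd_at [OF inj i(1)] assms(3) [OF i(1)] i(2) by (cases "u j") auto
  next
    case False
    then have "u j = Star" using assms(2) by (auto simp: propset_def)
    then show ?thesis using False by (metis wrd_eq_Star)
  qed
qed

lemma domino_split: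
  assumes "w j = Star"
  shows "domino (w(j := Zero)) \<union> domino (w(j := One)) = domino w"
proof (rule set_eqI)
  fix x :: "real ^ 'a"
  have "x \<in> domino (w(j := a)) \<longleftrightarrow> x $ j \<in> side a \<and> (\<forall>k. k \<noteq> j \<longrightarrow> x $ k \<in> side (w k))" for a
    by (auto simp: domino_def)
  moreover have "x \<in> domino w \<longleftrightarrow> x $ j \<in> side Star \<and> (\<forall>k. k \<noteq> j \<longrightarrow> x $ k \<in> side (w k))"
    unfolding domino_def mem_Collect_eq using assms by metis
  moreover have "x $ j \<in> side Star \<longleftrightarrow> x $ j \<in> side Zero \<or> x $ j \<in> side One" by auto
  ultimately show "x \<in> domino (w(j := Zero)) \<union> domino (w(j := One)) \<longleftrightarrow> x \<in> domino w"
    by blast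
qed

text \<open>Disjoint classes make the labels of a vertex pairwise different positions, so its word
  has exactly one halved side for each direction.\<close>

locale word_labels =
  fixes I :: "'i set" and N :: "'i \<Rightarrow> 'n::finite set"
  assumes fin: "finite I" and disj: "disjoint_family_on N I"
begin

lemma N_unique: "i \<in> I \<Longrightarrow> j \<in> I \<Longrightarrow> k \<in> N i \<Longrightarrow> k \<in> N j \<Longrightarrow> i = j"
  using disj by (auto simp: disjoint_family_on_def)

lemma inj_on_label: "(\<And>i. i \<in> I \<Longrightarrow> w i \<in> N i) \<Longrightarrow> inj_on w I"
  by (rule inj_onI) (metis N_unique)

lemma labels_in: "labelling I N l \<Longrightarrow> S \<subseteq> I \<Longrightarrow> i \<in> I \<Longrightarrow> l S i \<in> N i"
  by (simp add: labelling_def)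

lemma inj_on_labelling: "labelling I N l \<Longrightarrow> S \<subseteq> I \<Longrightarrow> inj_on (l S) I"
  by (intro inj_on_label labels_in)

lemma dich_words:
  assumes l: "labelling I N l" and "S \<subseteq> I" "T \<subseteq> I" "S \<noteq> T"
  shows "dich (wrd I (l S) S) (wrd I (l T) T)"
proof -
  obtain i where i: "i \<in> I" "i \<in> S \<longleftrightarrow> i \<notin> T" "l S i = l T i"
    using assms unfolding labelling_def by (metis cube_codeD)
  have "wrd I (l S) S (l S i) = (if i \<in> S then One else Zero)"
    using wrd_at [OF inj_on_labelling [OF l assms(2)] i(1)] .
  moreover have "wrd I (l T) T (l S i) = (if i \<in> T then One else Zero)"
    using wrd_at [OF inj_on_labelling [OF l assms(3)] i(1)] unfolding i(3) .
  ultimately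
  show ?thesis unfolding dich_def using i(2) by (intro exI [of _ "l S i"]) auto
qed

lemma inj_on_words: "labelling I N l \<Longrightarrow> inj_on (\<lambda>S. wrd I (l S) S) (Pow I)"
  by (rule inj_onI) (metis PowD dich_words not_dich_refl)

text \<open>Without direction \<open>i\<close> the two ends of a twin edge give the same word
  \<open>w\<close>, which is \<open>Star\<close> on \<open>N i\<close>. Old and new pair both arise
  by putting \<open>Zero\<close> and \<open>One\<close> at one position of \<open>w\<close>, so both
  have the union \<open>domino w\<close>. This yields the twin pairs and also keeps the cube
  covered.\<close>

lemma flip_step_move:
  assumes l: "labelling I N l" and tiles: "tiling (card I) (words I l)" and move: "move I N K l l'"
  shows "tiling (card I) (words I l') \<and> (words I l' = words I l \<or> flip_step (card I) (words I l) (words I l'))"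
proof -
  obtain S i z where tw: "twin I l S i" and z: "z \<in> N i" and l'_def: "l' = relabel l S i z"
    using move unfolding move_def by blast
  let ?T = "tog i S"
  have S: "S \<subseteq> I" "i \<in> I" "?T \<subseteq> I" using tw by (auto simp: twin_def)
  have l': "labelling I N l'" using move_labelling [OF move l] .
  have lT: "l ?T i = l S i" using l S by (auto simp: labelling_def intro: cube_code_tog)
  show ?thesis
  proof (cases "z = l S i")
    case True
    then have "l' = l" using lT by (auto simp: l'_def relabel_def fun_eq_iff)
    then show ?thesis using tiles by simp
  next
    case False
    define w where "w = wrd (I - {i}) (l S) S"
    let ?W = "\<lambda>l S. wrd I (l S) S"
    have agree: "l ?T j = l S j" "l' S j = l S j" "l' ?T j = l S j" if "j \<in> I" "j \<noteq> i" for j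
      using tw that by (auto simp: twin_def l'_def)
    have rest: "wrd (I - {i}) (l ?T) ?T = w" "wrd (I - {i}) (l' S) S = w" "wrd (I - {i}) (l' ?T) ?T = w"
      unfolding w_def using agree by (auto intro!: wrd_cong simp: in_tog)
    have lz: "l' S i = z" "l' ?T i = z" by (simp_all add: l'_def)
    have W: "?W l S = w(l S i := if i \<in> S then One else Zero)"
      "?W l ?T = w(l S i := if i \<in> S then Zero else One)"
      "?W l' S = w(z := if i \<in> S then One else Zero)"
      "?W l' ?T = w(z := if i \<in> S then Zero else One)"
      using wrd_remove [OF inj_on_labelling [OF l S(1)] S(2), of S]
        wrd_remove [OF inj_on_labelling [OF l S(3)] S(2), of ?T]
        wrd_remove [OF inj_on_labelling [OF l' S(1)] S(2), of S]
        wrd_remove [OF inj_on_labelling [OF l' S(3)] S(2), of ?T]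
      by (simp_all add: rest lT lz in_tog w_def)
    have star: "w k = Star" if "k \<in> N i" for k
      unfolding w_def wrd_eq_Star using that labels_in [OF l S(1)] N_unique S(2) by blast
    have liN: "l S i \<in> N i" using labels_in [OF l S(1,2)] .
    have un: "domino (?W l S) \<union> domino (?W l ?T) = domino w"
      "domino (?W l' S) \<union> domino (?W l' ?T) = domino w"
      unfolding W using domino_split [of w "l S i", OF star [OF liN]] domino_split [of w z, OF star [OF z]]
      by (auto simp: Un_commute)
    have new: "words I l' = words I l - {?W l S, ?W l ?T} \<union> {?W l' S, ?W l' ?T}"
    proof -
      have Pow: "Pow I = (Pow I - {S, ?T}) \<union> {S, ?T}" using S by blast
      have "?W l ` Pow I - {?W l S, ?W l ?T} = ?W l ` (Pow I - {S, ?T})"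
        using inj_on_image_set_diff [OF inj_on_words [OF l], of "Pow I" "{S, ?T}"] S by auto
      also have "\<dots> = ?W l' ` (Pow I - {S, ?T})"
        by (rule image_cong) (auto simp: l'_def)
      finally have "words I l - {?W l S, ?W l ?T} = ?W l' ` (Pow I - {S, ?T})"
        by (simp only: words_def)
      moreover have "words I l' = ?W l' ` (Pow I - {S, ?T}) \<union> {?W l' S, ?W l' ?T}"
        unfolding words_def by (subst Pow) (simp only: image_Un image_insert image_empty)
      ultimately show ?thesis by simp
    qed
    have inD: "?W l S \<in> words I l" "?W l ?T \<in> words I l" using S by (auto simp: words_def)
    have card: "card (propset (wrd I (m U) U)) = card I" if "labelling I N m" "U \<subseteq> I" for m :: "'i set \<Rightarrow> 'i \<Rightarrow> 'n" and U
      using inj_on_labelling [OF that] by (simp add: propset_wrd card_image)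
    have dw: "domino_word (card I - 1) w"
      unfolding domino_word_def w_def propset_wrd
      using inj_on_labelling [OF l S(1)] S(2) fin
      by (subst card_image) (auto intro: inj_on_subset)
    have tiles': "tiling (card I) (words I l')"
      unfolding tiling_def
    proof (intro conjI ballI impI)
      show "domino_word (card I) u" if "u \<in> words I l'" for u
        using that card [OF l'] by (auto simp: words_def domino_word_def)
      show "interior (domino u) \<inter> interior (domino v) = {}"
        if "u \<in> words I l'" "v \<in> words I l'" "u \<noteq> v" for u v
        unfolding interiors_disjoint_iff using that dich_words [OF l'] by (auto simp: words_def)
      have "\<Union> (domino ` words I l') = \<Union> (domino ` (words I l - {?W l S, ?W l ?T})) \<union> domino w"
        unfolding new using un(2) by auto
      also have "\<dots> = \<Union> (domino ` words I l)" using un(1) inD by auto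
      also have "\<dots> = {x. \<forall>j. x $ j \<in> {0..2}}" using tiles by (simp add: tiling_def)
      finally show "\<Union> (domino ` words I l') = {x. \<forall>j. x $ j \<in> {0..2}}" .
    qed
    have twin: "twin_pair (card I) (?W l S) (?W l ?T)" "twin_pair (card I) (?W l' S) (?W l' ?T)"
      unfolding twin_pair_def domino_word_def
      using card [OF l S(1)] card [OF l S(3)] card [OF l' S(1)] card [OF l' S(3)] un dw
      by (auto simp: domino_word_def)
    \<comment> \<open>The new pair differs from the old one: position \<open>z\<close> is halved in
      its members but not in the old ones.\<close>
    have "?W l' S z \<noteq> Star" "?W l S z = Star" "?W l ?T z = Star"
      unfolding W using False star [OF z] by auto
    then have "?W l' S \<notin> {?W l S, ?W l ?T}" by auto
    then have "is_flip (card I) (?W l S) (?W l ?T) (?W l' S) (?W l' ?T)"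
      unfolding is_flip_def using twin un by auto
    then have "flip_step (card I) (words I l) (words I l')"
      unfolding flip_step_def using tiles tiles' inD new by blast
    then show ?thesis using tiles' by blast
  qed
qed

end

definition flip_fixing :: "nat \<Rightarrow> 'n::finite word set \<Rightarrow> 'n word set \<Rightarrow> 'n word set \<Rightarrow> bool" where
  "flip_fixing d C D D' \<longleftrightarrow> flip_step d D D' \<and> C \<subseteq> D \<and> C \<subseteq> D'"

text \<open>Frozen vertices keep their labels and hence their words, which make up \<open>C\<close>.
  A move that leaves the set of words unchanged contributes no flip.\<close>

lemma (in word_labels) flips_of_moves:
  assumes l: "labelling I N l" and tiles: "tiling (card I) (words I l)"
    and moves: "(move I N K)\<^sup>*\<^sup>* l l'" and K: "K \<subseteq> Pow I" and C: "C = (\<lambda>S. wrd I (l S) S) ` K"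
  shows "(flip_fixing (card I) C)\<^sup>*\<^sup>* (words I l) (words I l') \<and> tiling (card I) (words I l')"
  using moves
proof (induction rule: rtranclp_induct)
  case (step l1 l2)
  have sub: "C \<subseteq> words I l'" if "(move I N K)\<^sup>*\<^sup>* l l'" for l'
  proof
    fix u assume "u \<in> C"
    then obtain S where S: "S \<in> K" "u = wrd I (l S) S" using C by blast
    then have "u = wrd I (l' S) S" using moves_keep [OF that] by simp
    then show "u \<in> words I l'" using S(1) K unfolding words_def by blast
  qed
  have "labelling I N l1" using moves_labelling [OF step.hyps(1) l] .
  from flip_step_move [OF this conjunct2 [OF step.IH] step.hyps(2)]
  have *: "tiling (card I) (words I l2)"
    "words I l2 = words I l1 \<or> flip_step (card I) (words I l1) (words I l2)" by blast+
  have "C \<subseteq> words I l1" "C \<subseteq> words I l2"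
    using sub step.hyps by (auto intro: rtranclp.rtrancl_into_rtrancl)
  then have "words I l2 = words I l1 \<or> flip_fixing (card I) C (words I l1) (words I l2)"
    using *(2) by (auto simp: flip_fixing_def)
  then show ?case using step.IH *(1) by (metis rtranclp.rtrancl_into_rtrancl)
qed (use tiles in simp)

section \<open>Simple and regular tilings as labellings\<close>

lemma words_pure:
  assumes "\<And>S. S \<subseteq> I \<Longrightarrow> pure I P (l S)"
  shows "words I l = words I (\<lambda>_. P)"
  unfolding words_def using assms by (intro image_cong wrd_cong) (auto simp: pure_def)

lemma simple_tiling_words:
  fixes Q :: "'n::finite word set"
  assumes Q: "tiling d Q" "\<And>u. u \<in> Q \<Longrightarrow> propset u = P ` I" and inj: "inj_on P I"
  shows "Q = words I (\<lambda>_. P)"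
proof
  show "Q \<subseteq> words I (\<lambda>_. P)"
  proof
    fix u assume u: "u \<in> Q"
    have "u = wrd I P {i \<in> I. u (P i) = One}"
      by (rule wrd_eqI [OF inj Q(2) [OF u]]) simp
    then show "u \<in> words I (\<lambda>_. P)" by (auto simp: words_def)
  qed
  show "words I (\<lambda>_. P) \<subseteq> Q"
  proof
    fix v assume "v \<in> words I (\<lambda>_. P)"
    then obtain S where S: "S \<subseteq> I" "v = wrd I P S" by (auto simp: words_def)
    obtain u where u: "u \<in> Q" "\<And>j. u j = Zero \<Longrightarrow> j \<notin> P ` S" "\<And>j. u j = One \<Longrightarrow> j \<in> P ` S"
      using tiling_covers [OF Q(1), of "\<lambda>j. j \<in> P ` S"] by blast
    have "u = wrd I P S"
    proof (rule wrd_eqI [OF inj Q(2) [OF u(1)]])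
      fix i assume i: "i \<in> I"
      then have "u (P i) \<noteq> Star" using Q(2) [OF u(1)] by (auto simp: propset_def)
      moreover have "P i \<in> P ` S \<longleftrightarrow> i \<in> S" using inj i S(1) by (auto dest: inj_onD)
      ultimately show "u (P i) = One \<longleftrightarrow> i \<in> S"
        using u(2,3) [of "P i"] by (cases "u (P i)") auto
    qed
    then show "v \<in> Q" using u(1) S(2) by simp
  qed
qed

text \<open>The label of a word in direction \<open>i\<close> is its only non-star position
  \<open>p u i\<close> in \<open>N i\<close>. Covering provides a word for each vertex; disjointness
  provides the cube code and shows that no vertex has two words.\<close>

lemma regular_tiling_labelling:
  fixes D :: "'n::finite word set"
  assumes "regular_tiling d D"
  obtains N :: "nat \<Rightarrow> 'n set" and l where "disjoint_family_on N {1..d}" "labelling {1..d} N l"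
    "D = words {1..d} l"
proof -
  let ?I = "{1..d}"
  have tiles: "tiling d D"
    using assms unfolding regular_tiling_def by (rule conjunct1)
  obtain N :: "nat \<Rightarrow> 'n set" and M where
    N: "disjoint_family_on N ?I" and M: "(\<Union>i\<in>?I. N i) \<union> M = UNIV"
    and classes: "\<forall>i\<in>?I. N i \<noteq> {} \<and> (\<lambda>u. restrict u (N i)) ` D =
        {w \<in> N i \<rightarrow>\<^sub>E UNIV. \<exists>!j. j \<in> N i \<and> w j \<noteq> Star}"
    and star: "\<forall>u\<in>D. \<forall>j\<in>M. u j = Star"
    using assms unfolding regular_tiling_def by (elim conjE exE)
  have one: "(\<lambda>u. restrict u (N i)) ` D = {w \<in> N i \<rightarrow>\<^sub>E UNIV. \<exists>!j. j \<in> N i \<and> w j \<noteq> Star}"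
    if "i \<in> ?I" for i
    using bspec [OF classes that] by (rule conjunct2)
  interpret word_labels ?I N using N by unfold_locales simp_all
  have ex1: "\<exists>!j. j \<in> N i \<and> u j \<noteq> Star" if "u \<in> D" "i \<in> ?I" for u i
  proof -
    have "restrict u (N i) \<in> (\<lambda>u. restrict u (N i)) ` D" using that(1) by (rule imageI)
    then have "\<exists>!j. j \<in> N i \<and> restrict u (N i) j \<noteq> Star"
      unfolding one [OF that(2)] mem_Collect_eq by (rule conjunct2)
    moreover have "j \<in> N i \<and> restrict u (N i) j \<noteq> Star \<longleftrightarrow> j \<in> N i \<and> u j \<noteq> Star" for j
      by auto
    ultimately show ?thesis by (simp only:)
  qed
  define p where "p u i = (THE j. j \<in> N i \<and> u j \<noteq> Star)" for u i
  have p: "p u i \<in> N i" "u (p u i) \<noteq> Star" "\<And>j. j \<in> N i \<Longrightarrow> u j \<noteq> Star \<Longrightarrow> j = p u i"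
    if "u \<in> D" "i \<in> ?I" for u i
  proof -
    show 1: "p u i \<in> N i" "u (p u i) \<noteq> Star"
      using theI' [OF ex1 [OF that]] unfolding p_def by (rule conjunct1, rule conjunct2)
    show "j = p u i" if "j \<in> N i" "u j \<noteq> Star" for j
      using ex1 [OF \<open>u \<in> D\<close> \<open>i \<in> ?I\<close>] 1 that by (elim ex1E) metis
  qed
  have props: "propset u = p u ` ?I" if u: "u \<in> D" for u
  proof
    show "propset u \<subseteq> p u ` ?I"
    proof
      fix j assume "j \<in> propset u"
      then have j: "u j \<noteq> Star" by (simp add: propset_def)
      then have "j \<notin> M" using star u by blast
      then obtain i where "i \<in> ?I" "j \<in> N i" using M by blast
      then show "j \<in> p u ` ?I" using p(3) [OF u] j by blast
    qed
    show "p u ` ?I \<subseteq> propset u" using p(2) [OF u] by (auto simp: propset_def)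
  qed
  have inj: "inj_on (p u) ?I" if "u \<in> D" for u
    using p(1) [OF that] by (rule inj_on_label)
  \<comment> \<open>Cover the unit cube that lies in the upper half exactly at the positions of the
    classes \<open>N i\<close> with \<open>i \<in> S\<close>; the halved side of the covering word
    in each class shows the right coordinate.\<close>
  have "\<exists>u\<in>D. \<forall>i\<in>?I. u (p u i) = One \<longleftrightarrow> i \<in> S" if S: "S \<subseteq> ?I" for S
  proof -
    obtain u where u: "u \<in> D" "\<And>j. u j = Zero \<Longrightarrow> \<not> (\<exists>i\<in>S. j \<in> N i)" "\<And>j. u j = One \<Longrightarrow> \<exists>i\<in>S. j \<in> N i"
      using tiling_covers [OF tiles, of "\<lambda>j. \<exists>i\<in>S. j \<in> N i"] by blast
    have "u (p u i) = One \<longleftrightarrow> i \<in> S" if i: "i \<in> ?I" for i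
    proof -
      have "(\<exists>k\<in>S. p u i \<in> N k) \<longleftrightarrow> i \<in> S"
        using p(1) [OF u(1) i] N_unique [OF i] S by blast
      then show ?thesis
        using u(2,3) [of "p u i"] p(2) [OF u(1) i] by (cases "u (p u i)") auto
    qed
    then show ?thesis using u(1) by blast
  qed
  then obtain U where U: "\<And>S. S \<subseteq> ?I \<Longrightarrow> U S \<in> D"
    "\<And>S i. S \<subseteq> ?I \<Longrightarrow> i \<in> ?I \<Longrightarrow> U S (p (U S) i) = One \<longleftrightarrow> i \<in> S"
    by metis
  let ?l = "\<lambda>S. p (U S)"
  have word: "U S = wrd ?I (?l S) S" if "S \<subseteq> ?I" for S
    using inj [OF U(1) [OF that]] props [OF U(1) [OF that]] U(2) [OF that] by (rule wrd_eqI)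
  \<comment> \<open>The position separating two words is halved in both, so it is their common label
    in the direction of its class.\<close>
  have opposite: "\<exists>i\<in>?I. p u i = p v i \<and> (u (p u i) = One \<longleftrightarrow> v (p v i) \<noteq> One)"
    if uv: "u \<in> D" "v \<in> D" "u \<noteq> v" for u v
  proof -
    obtain j where j: "u j = Zero \<and> v j = One \<or> u j = One \<and> v j = Zero"
      using tiling_dich [OF tiles uv] unfolding dich_def by blast
    then have "j \<in> propset u" by (auto simp: propset_def)
    then obtain i where i: "i \<in> ?I" "j = p u i" using props [OF uv(1)] by blast
    then have "j = p v i" using p(1) [OF uv(1) i(1)] j by (intro p(3) [OF uv(2) i(1)]) auto
    then show ?thesis using i j by auto
  qed
  have "labelling ?I N ?l"
    unfolding labelling_def cube_code_def
  proof (intro conjI allI impI ballI)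
    fix S T assume ST: "S \<subseteq> ?I" "T \<subseteq> ?I" "S \<noteq> T"
    have "U S \<noteq> U T"
    proof
      assume "U S = U T"
      then have "i \<in> S \<longleftrightarrow> i \<in> T" if "i \<in> ?I" for i using U(2) ST that by metis
      then show False using ST by blast
    qed
    then obtain i where "i \<in> ?I" "?l S i = ?l T i"
      "U S (p (U S) i) = One \<longleftrightarrow> U T (p (U T) i) \<noteq> One"
      using opposite U(1) ST by metis
    then show "\<exists>i\<in>sym_diff S T. ?l S i = ?l T i" using U(2) ST by blast
  next
    fix S i assume "S \<subseteq> ?I" "i \<in> ?I"
    then show "?l S i \<in> N i" using p(1) U(1) by blast
  qed
  moreover have "D = words ?I ?l"
  proof
    show "words ?I ?l \<subseteq> D" using word U(1) by (auto simp: words_def)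
    show "D \<subseteq> words ?I ?l"
    proof
      fix u assume u: "u \<in> D"
      let ?S = "{i \<in> ?I. u (p u i) = One}"
      have S: "?S \<subseteq> ?I" by blast
      have "u = U ?S"
      proof (rule ccontr)
        assume "u \<noteq> U ?S"
        then obtain i where "i \<in> ?I" "u (p u i) = One \<longleftrightarrow> U ?S (p (U ?S) i) \<noteq> One"
          using opposite [OF u U(1) [OF S]] by blast
        then show False using U(2) [OF S] by blast
      qed
      then have "u = wrd ?I (?l ?S) ?S" using word [OF S] by simp
      then show "u \<in> words ?I ?l" using S unfolding words_def by blast
    qed
  qed
  ultimately show thesis using that N by blast
qed

section \<open>Assembling the sequence of flips\<close>

lemma flip_sequence:
  assumes "(flip_fixing d C)\<^sup>*\<^sup>* D Q" "tiling d D" "C \<subseteq> D"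
  shows "\<exists>(m::nat) T. 1 \<le> m \<and> T 1 = D \<and> T m = Q \<and>
    (\<forall>t\<in>{1..m}. tiling d (T t) \<and> C \<subseteq> T t) \<and> (\<forall>t\<in>{1..<m}. flip_step d (T t) (T (t + 1)))"
proof -
  obtain n where "(flip_fixing d C ^^ n) D Q" using assms(1) by (meson rtranclp_imp_relpowp)
  then obtain f where f: "f 0 = D" "f n = Q" "\<And>i. i < n \<Longrightarrow> flip_fixing d C (f i) (f (Suc i))"
    unfolding relpowp_fun_conv by blast
  have inv: "tiling d (f i) \<and> C \<subseteq> f i" if "i \<le> n" for i
  proof (cases i)
    case 0
    then show ?thesis using f(1) assms by simp
  next
    case (Suc k)
    then show ?thesis using f(3) [of k] that by (auto simp: flip_fixing_def flip_step_def)
  qed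
  \<comment> \<open>Shifts the index, since \<open>f\<close> starts at 0 and the required sequence
    at 1.\<close>
  let ?T = "\<lambda>t. f (t - 1)"
  have step: "flip_step d (?T t) (?T (t + 1))" if "t \<in> {1..<Suc n}" for t
    using f(3) [of "t - 1"] that by (auto simp: flip_fixing_def)
  have good: "tiling d (?T t) \<and> C \<subseteq> ?T t" if "t \<in> {1..Suc n}" for t
  proof -
    have "t - 1 \<le> n" using that by auto
    then show ?thesis by (rule inv)
  qed
  show ?thesis
  proof (intro exI conjI ballI)
    show "1 \<le> Suc n" "?T 1 = D" "?T (Suc n) = Q" using f(1,2) by simp_all
    fix t assume "t \<in> {1..Suc n}"
    then show "tiling d (?T t)" "C \<subseteq> ?T t" using good by blast+
  next
    fix t assume "t \<in> {1..<Suc n}"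
    then show "flip_step d (?T t) (?T (t + 1))" by (rule step)
  qed
qed

text \<open>Used to pair old with new positions. Fixing the common elements makes the sets
  \<open>{x, g x}\<close> for \<open>x \<in> A\<close> pairwise disjoint, so that they can serve as
  label classes.\<close>

lemma bij_betw_fixing_common:
  assumes "finite A" "finite B" "card A = card B"
  obtains g where "bij_betw g A B" "\<And>x. x \<in> A \<Longrightarrow> x \<in> B \<Longrightarrow> g x = x"
proof -
  have "card (A - B) = card (B - A)"
    using assms card_Diff_subset_Int [of A B] card_Diff_subset_Int [of B A] by (simp add: Int_commute)
  then obtain h where h: "bij_betw h (A - B) (B - A)"
    using assms finite_same_card_bij by (metis finite_Diff)
  let ?g = "\<lambda>x. if x \<in> B then x else h x"
  have "bij_betw ?g (A \<inter> B \<union> (A - B)) (A \<inter> B \<union> (B - A))"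
    by (rule bij_betw_combine) (use h in \<open>auto simp: bij_betw_def inj_on_def\<close>)
  moreover have "A \<inter> B \<union> (A - B) = A" "A \<inter> B \<union> (B - A) = B" by auto
  ultimately show thesis using that [of ?g] by simp
qed

theorem theorem4:
  fixes d :: nat and D Q C :: "'n::finite word set"
  assumes "1 \<le> d" and "d \<le> 5" and "d < CARD('n)"
    and "regular_tiling d D"
    and "simple_component C D"
    and "simple_tiling d Q"
    and "C \<subseteq> Q"
  shows "\<exists>(m::nat) (T :: nat \<Rightarrow> 'n word set).
           1 \<le> m \<and> T 1 = D \<and> T m = Q \<and>
           (\<forall>t\<in>{1..m}. tiling d (T t) \<and> C \<subseteq> T t) \<and>
           (\<forall>t\<in>{1..<m}. flip_step d (T t) (T (t + 1)))"
proof -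
  let ?I = "{1..d}"
  have CD: "C \<subseteq> D" and tD: "tiling d D" and tQ: "tiling d Q"
    using assms(4-6) by (auto simp: simple_component_def regular_tiling_def simple_tiling_def)
  obtain N l where N: "disjoint_family_on N ?I" and l: "labelling ?I N l" and D: "D = words ?I l"
    using regular_tiling_labelling [OF assms(4)] .
  interpret word_labels ?I N using N by unfold_locales simp_all
  have labels: "l S i \<in> N i" if "S \<subseteq> ?I" "i \<in> ?I" for S i using labels_in [OF l that] .
  \<comment> \<open>Some word of \<open>Q\<close> has to cover the centre of the unit cube that lies
    in the upper half in every coordinate.\<close>
  have "Q \<noteq> {}"
  proof
    assume "Q = {}"
    from tQ show False by (rule tiling_covers [where f = "\<lambda>_. True"]) (simp add: \<open>Q = {}\<close>)
  qed
  then obtain q where q: "q \<in> Q" by blast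
  have Qq: "propset u = propset q" if "u \<in> Q" for u
    using assms(6) q that unfolding simple_tiling_def by blast
  have tiles: "tiling (card ?I) (words ?I l)" using tD D by simp
  have "(flip_fixing d C)\<^sup>*\<^sup>* D Q"
  proof (cases "C = {}")
    case False
    then obtain S0 where S0: "S0 \<subseteq> ?I" "wrd ?I (l S0) S0 \<in> C"
      using CD unfolding D words_def by blast
    let ?P = "l S0" and ?K = "{S \<in> Pow ?I. wrd ?I (l S) S \<in> C}"
    have pq: "propset q = ?P ` ?I" using Qq S0(2) assms(7) propset_wrd by (metis subsetD)
    have "pure ?I ?P (l S)" if S: "S \<in> ?K" for S
      unfolding pure_def
    proof
      fix i assume i: "i \<in> ?I"
      \<comment> \<open>Words of \<open>C\<close> lie in the simple tiling \<open>Q\<close>, so they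
        have the same set of labels; disjointness of the classes then matches the labels direction
        by direction.\<close>
      have "l S ` ?I = ?P ` ?I" using Qq S assms(7) propset_wrd pq by (metis (no_types, lifting) mem_Collect_eq subsetD)
      then obtain j where "j \<in> ?I" "l S i = ?P j" using i by blast
      then show "l S i = ?P i" using labels S S0(1) i N_unique by (metis (no_types, lifting) PowD mem_Collect_eq)
    qed
    then have "conn ?I N ?K ?P l"
      using assms(2) labels [OF S0(1)] l by (intro labellings_connected) auto
    then obtain l' where l': "(move ?I N ?K)\<^sup>*\<^sup>* l l'" "\<And>S. S \<subseteq> ?I \<Longrightarrow> pure ?I ?P (l' S)"
      unfolding conn_def by blast
    have "C = (\<lambda>S. wrd ?I (l S) S) ` ?K" using CD unfolding D words_def by auto
    then have "(flip_fixing d C)\<^sup>*\<^sup>* D (words ?I l')"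
      using flips_of_moves [OF l tiles l'(1)] D by auto
    moreover have "Q = words ?I (\<lambda>_. ?P)"
      by (rule simple_tiling_words [OF tQ]) (use Qq pq inj_on_labelling [OF l S0(1)] in auto)
    ultimately show ?thesis using words_pure [of ?I ?P l'] l'(2) by simp
  next
    case True
    \<comment> \<open>With nothing to keep fixed, \<open>D\<close> is first brought to the simple
      tiling with the constant labels of the vertex \<open>{}\<close>.\<close>
    let ?P = "l {}"
    have "conn ?I N {} ?P l"
      using assms(2) labels l by (intro labellings_connected) auto
    then obtain l1 where l1: "(move ?I N {})\<^sup>*\<^sup>* l l1" "\<And>S. S \<subseteq> ?I \<Longrightarrow> pure ?I ?P (l1 S)"
      unfolding conn_def by blast
    have w1: "words ?I l1 = words ?I (\<lambda>_. ?P)" using words_pure l1(2) by blast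
    have 1: "(flip_fixing d C)\<^sup>*\<^sup>* D (words ?I (\<lambda>_. ?P))" "tiling d (words ?I (\<lambda>_. ?P))"
      using flips_of_moves [OF l tiles l1(1), of C] True D w1 by auto
    text \<open>\<open>Q\<close> need not be compatible with the given partition of the positions; a second partition
      takes over, in which each class consists of an old and a new position.\<close>
    have injP: "inj_on ?P ?I" using inj_on_labelling [OF l] by blast
    have "card (propset q) = d" using tQ q by (auto simp: tiling_def domino_word_def)
    then obtain g where g: "bij_betw g (?P ` ?I) (propset q)"
      "\<And>x. x \<in> ?P ` ?I \<Longrightarrow> x \<in> propset q \<Longrightarrow> g x = x"
      using bij_betw_fixing_common [of "?P ` ?I" "propset q"] card_image [OF injP] by auto
    let ?G = "\<lambda>i. g (?P i)" and ?N = "\<lambda>i. {?P i, g (?P i)}"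
    have G: "inj_on ?G ?I" "?G ` ?I = propset q"
      using comp_inj_on [OF injP, of g] g(1) by (auto simp: bij_betw_def comp_def image_image)
    have Pi: "?P i = ?P j \<longleftrightarrow> i = j" "?G i = ?G j \<longleftrightarrow> i = j" if "i \<in> ?I" "j \<in> ?I" for i j
      using that injP G(1) by (auto dest: inj_onD)
    \<comment> \<open>An old position that is also a new one is fixed by \<open>g\<close>, so it
      cannot be the partner of another old position.\<close>
    have mixed: "i = j" if "i \<in> ?I" "j \<in> ?I" "?P i = ?G j" for i j
    proof -
      have "?P i \<in> propset q" using that G(2) by (metis image_eqI)
      then have "?G i = ?G j" using g(2) that by (metis image_eqI)
      then show ?thesis using Pi(2) that by blast
    qed
    interpret N': word_labels ?I ?N
    proof
      show "disjoint_family_on ?N ?I"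
        unfolding disjoint_family_on_def
      proof (intro ballI impI)
        fix i j assume ij: "i \<in> ?I" "j \<in> ?I" "i \<noteq> j"
        have "?P i \<noteq> ?P j" "?G i \<noteq> ?G j" "?P i \<noteq> ?G j" "?G i \<noteq> ?P j"
          using Pi [OF ij(1,2)] mixed [OF ij(1,2)] mixed [OF ij(2,1)] ij(3) by metis+
        then show "?N i \<inter> ?N j = {}" by simp
      qed
    qed simp
    have lab: "labelling ?I ?N (\<lambda>_. ?P)"
      unfolding labelling_def cube_code_def by blast
    then have "conn ?I ?N {} ?G (\<lambda>_. ?P)"
      using assms(2) by (intro labellings_connected) auto
    then obtain l2 where l2: "(move ?I ?N {})\<^sup>*\<^sup>* (\<lambda>_. ?P) l2" "\<And>S. S \<subseteq> ?I \<Longrightarrow> pure ?I ?G (l2 S)"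
      unfolding conn_def by blast
    have "words ?I l2 = words ?I (\<lambda>_. ?G)" using words_pure l2(2) by blast
    moreover have "Q = words ?I (\<lambda>_. ?G)"
      by (rule simple_tiling_words [OF tQ]) (use Qq G in auto)
    ultimately have "(flip_fixing d C)\<^sup>*\<^sup>* (words ?I (\<lambda>_. ?P)) Q"
      using N'.flips_of_moves [OF lab _ l2(1), of C] 1(2) True by simp
    with 1(1) show ?thesis by simp
  qed
  then show ?thesis using tD CD by (rule flip_sequence)
qed

end
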